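(* For every positive integer $k$, \[\binom{\lfloor k^2/2\rfloor}{\lfloor k^2/4\rfloor}^{k}\left(f^{\lambda_{\lfloor k/2\rfloor\times\lceil k/2\rceil}}\right)^{2k}\;\le\;\big|\mathrm{SAv}_{k^3}(12\cdots(k+1))\big|\;\le\;\left(f^{\lambda_{k^2\times k}}\right)^2 .\]
   Context: Permutations $\pi\in S_n$ are identified with words $\pi(1)\cdots\pi(n)$. For $\tau\in S_m$, entries $\pi(i_1),\ldots,\pi(i_m)$ with $i_1<\cdots<i_m$ form an occurrence of $\tau$ if for all $j,l$, $\pi(i_j)<\pi(i_l)$ iff $\tau(j)<\tau(l)$; $\pi$ avoids $\tau$ if there is no occurrence. A permutation $\pi\in S_n$ strongly avoids $\tau$ if both $\pi$ and $\pi^2$ (square in the group $S_n$, i.e. $\pi\circ\pi$) avoid $\tau$; $\mathrm{SAv}_n(\tau)$ is the set of $\pi\in S_n$ strongly avoiding $\tau$. Here $12\cdots(k+1)$ is the identity permutation of $S_{k+1}$. For positive integers $p,q$, $\lambda_{p\times q}$ is the partition $(q,q,\ldots,q)$ with $p$ parts (a $p\times q$ rectangle) and $f^{\lambda_{p\times q}}$ is the number of standard Young tableaux of that shape, namely $f^{\lambda_{p\times q}}=\frac{(pq)!}{\prod_{i=1}^p\prod_{j=1}^q(i+j-1)}$; for $p=0$ (empty shape) this number is $1$. *)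

theory Defs
  imports "HOL-Combinatorics.Permutations" "HOL-Library.FuncSet"
begin

text \<open>The word $\pi(1)\cdots\pi(n)$ of a permutation of $\{1,\dots,n\}$ is a function
  permuting \<open>{1..n}\<close>. An occurrence of a pattern \<open>\<tau>\<close> of length \<open>m\<close> in \<open>\<pi>\<close> is given by its
  positions $\iota(1) < \cdots < \iota(m)$.\<close>

definition occurrence ::
    "nat \<Rightarrow> (nat \<Rightarrow> nat) \<Rightarrow> nat \<Rightarrow> (nat \<Rightarrow> nat) \<Rightarrow> (nat \<Rightarrow> nat) \<Rightarrow> bool" where
  "occurrence n \<pi> m \<tau> \<iota> \<longleftrightarrow>
     \<iota> \<in> {1..m} \<rightarrow> {1..n} \<and> strict_mono_on {1..m} \<iota> \<and>
     (\<forall>j\<in>{1..m}. \<forall>l\<in>{1..m}. \<pi> (\<iota> j) < \<pi> (\<iota> l) \<longleftrightarrow> \<tau> j < \<tau> l)"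

definition avoids :: "nat \<Rightarrow> (nat \<Rightarrow> nat) \<Rightarrow> nat \<Rightarrow> (nat \<Rightarrow> nat) \<Rightarrow> bool" where
  "avoids n \<pi> m \<tau> \<longleftrightarrow> \<not> (\<exists>\<iota>. occurrence n \<pi> m \<tau> \<iota>)"

definition SAv :: "nat \<Rightarrow> nat \<Rightarrow> (nat \<Rightarrow> nat) \<Rightarrow> (nat \<Rightarrow> nat) set" where
  "SAv n m \<tau> = {\<pi>. \<pi> permutes {1..n} \<and> avoids n \<pi> m \<tau> \<and> avoids n (\<pi> \<circ> \<pi>) m \<tau>}"

text \<open>Partitions are the lists of their parts; cells are (row, column) pairs, counted from 0.\<close>

definition young_diagram :: "nat list \<Rightarrow> (nat \<times> nat) set" where
  "young_diagram \<mu> = {(i, j). i < length \<mu> \<and> j < \<mu> ! i}"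

text \<open>Extensionality makes a tableau determined by its entries in the cells of the diagram,
  so that the tableaux of a given shape can be counted.\<close>

definition standard_young_tableaux :: "nat list \<Rightarrow> (nat \<times> nat \<Rightarrow> nat) set" where
  "standard_young_tableaux \<mu> =
     {T \<in> extensional (young_diagram \<mu>).
        bij_betw T (young_diagram \<mu>) {1..sum_list \<mu>} \<and>
        (\<forall>i j j'. (i, j) \<in> young_diagram \<mu> \<and> (i, j') \<in> young_diagram \<mu> \<and> j < j'
            \<longrightarrow> T (i, j) < T (i, j')) \<and>
        (\<forall>i i' j. (i, j) \<in> young_diagram \<mu> \<and> (i', j) \<in> young_diagram \<mu> \<and> i < i'
            \<longrightarrow> T (i, j) < T (i', j))}"

definition num_SYT :: "nat list \<Rightarrow> nat" where
  "num_SYT \<mu> = card (standard_young_tableaux \<mu>)"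

definition rect_shape :: "nat \<Rightarrow> nat \<Rightarrow> nat list" where
  "rect_shape p q = replicate p q"

end

theory Submission
  imports Defs Complex_Main
begin

text \<open>
  \<^bold>\<open>Upper bound.\<close> If $\pi$ strongly avoids $12\cdots(k+1)$ and decreases on a set $S$, then by the
  theorem of Erdos and Szekeres, applied to $\pi$ on $\pi(S)$, more than $k^2$ elements in $S$ would
  give a decreasing subsequence of length $k+1$ on $\pi(S)$, hence an increasing one of $\pi^2$. So
  the increasing subsequences of $\pi$ have length at most $k$ and the decreasing ones at most
  $k^2$. As $n = k^3$, recording for each position the lengths of the longest decreasing and
  increasing subsequences that end there is a bijection onto the cells of the $k^2 \times k$
  rectangle; the positions and the values in the cells form two standard tableaux that determine
  $\pi$.

  \<^bold>\<open>Lower bound.\<close> Every sequence $T_0,\dots,T_{k-1}$ of self-complementary standard tableaux of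
  the $k \times k$ square gives an element of the set: $\pi$ maps the entry of $T_r$ in a cell, moved to
  the $r$-th block of $k^2$ consecutive numbers, to the entry of $T_{k-1-r}$ in the cell turned by 90
  degrees. It remains to count self-complementary tableaux. Such a tableau is determined by the
  entries up to $k^2/2$, whose cells form a half shape, and the half shapes correspond to the $p$-subsets $U$ of $\{0,\dots,2p-1\}$,
  $p = \lfloor k/2\rfloor$. By the Frobenius formula the half shape of $U$ has
  $c\prod_{u\in U, v\notin U} |y_u-y_v|^{-1}$ tableaux with $y_a = a(2k-1-a)$ and $c$ independent of
  $U$. Up to a common sign the absolute values can be traded for $(-1)^{|U \cap B|}$, where $B$ is the set of
  odd numbers, and the resulting sum has a closed form: expanding the sign as
  $\sum_{A\subseteq U\cap B} (-2)^{|A|}$, only $A = B$ contributes.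
\<close>

section \<open>Partial fraction identities\<close>

text \<open>As a function of \<open>z\<close> the left side has limit 1 at infinity and simple poles
  at the \<open>x i\<close>; the numerators on the right are its residues up to sign. The induction
  works over every field: the coefficient of the new pole \<open>x w\<close> is the induction
  hypothesis taken at \<open>z = x w\<close>, hence \<open>z\<close> is arbitrary.\<close>

lemma prod_partial_fractions:
  fixes x :: "'i \<Rightarrow> 'a::field"
  assumes "finite I" "inj_on x I" "z \<notin> x ` I"
  shows "(\<Prod>j\<in>I. 1 - 1 / (z - x j)) =
         1 - (\<Sum>i\<in>I. (\<Prod>j\<in>I-{i}. 1 - 1 / (x i - x j)) / (z - x i))"
  using assms
proof (induction I arbitrary: z rule: finite_induct)
  case (insert w I)
  define c where "c i = (\<Prod>j\<in>I-{i}. 1 - 1 / (x i - x j))" for i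
  have xw: "x w \<notin> x ` I" and inj: "inj_on x I" and z: "z \<notin> x ` I" "z \<noteq> x w"
    using insert.prems insert.hyps by auto
  have split: "(\<Prod>j\<in>insert w I-{i}. 1 - 1 / (x i - x j)) = (1 - 1 / (x i - x w)) * c i" if "i \<in> I" for i
  proof -
    have "insert w I - {i} = insert w (I - {i})" using that insert.hyps by auto
    then show ?thesis using insert.hyps by (simp add: c_def)
  qed
  have cw: "(\<Prod>j\<in>I-{w}. 1 - 1 / (x w - x j)) = 1 - (\<Sum>i\<in>I. c i / (x w - x i))"
    using insert.IH[OF inj xw] insert.hyps by (simp add: c_def)
  \<comment> \<open>Separates two poles, so that all terms with a pole at \<open>x w\<close> can be
    collected.\<close>
  have frac: "c / ((z - a) * (z - b)) = c / ((a - b) * (z - a)) + c / ((b - a) * (z - b))"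
    if "a \<noteq> b" "z \<noteq> a" "z \<noteq> b" for a b c :: 'a
  proof -
    have "b - a \<noteq> 0" "a - b \<noteq> 0" "z - a \<noteq> 0" "z - b \<noteq> 0" using that by auto
    then show ?thesis by (simp add: divide_simps) (simp add: algebra_simps)
  qed
  have "(\<Sum>i\<in>I. c i / ((z - x i) * (z - x w))) =
        (\<Sum>i\<in>I. c i / ((x i - x w) * (z - x i)) + c i / ((x w - x i) * (z - x w)))"
    using xw z by (intro sum.cong refl frac) (metis imageI)+
  then have key: "(\<Sum>i\<in>I. c i / (z - x i)) / (z - x w) =
        (\<Sum>i\<in>I. c i / ((x i - x w) * (z - x i))) + (\<Sum>i\<in>I. c i / (x w - x i)) / (z - x w)"
    by (simp add: sum.distrib sum_divide_distrib)
  have "(\<Prod>j\<in>insert w I. 1 - 1 / (z - x j)) = (1 - 1 / (z - x w)) * (1 - (\<Sum>i\<in>I. c i / (z - x i)))"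
    using insert.hyps insert.IH[OF inj z(1)] by (simp add: c_def)
  also have "\<dots> = 1 - ((\<Sum>i\<in>I. c i / (z - x i)) - (\<Sum>i\<in>I. c i / ((x i - x w) * (z - x i)))
                     + (1 - (\<Sum>i\<in>I. c i / (x w - x i))) / (z - x w))"
    using key by (simp add: algebra_simps diff_divide_distrib)
  also have "(\<Sum>i\<in>I. c i / (z - x i)) - (\<Sum>i\<in>I. c i / ((x i - x w) * (z - x i))) =
             (\<Sum>i\<in>I. (1 - 1 / (x i - x w)) * c i / (z - x i))"
    by (simp add: sum_subtractf [symmetric] left_diff_distrib diff_divide_distrib)
  also have "1 - (\<dots> + (1 - (\<Sum>i\<in>I. c i / (x w - x i))) / (z - x w)) =
     1 - (\<Sum>i\<in>insert w I. (\<Prod>j\<in>insert w I-{i}. 1 - 1 / (x i - x j)) / (z - x i))"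
    using insert.hyps by (simp add: split cw del: insert_Diff_if Diff_insert0 Diff_empty)
  finally show ?case .
qed simp

text \<open>Obtained by comparing the coefficients of 1/z and 1/z^2 when the partial fraction
  identity is expanded at infinity. The second identity, applied to beta numbers, closes the
  induction in \<open>frobenius_formula\<close>.\<close>

lemma sum_shift_quotients:
  fixes x :: "'i \<Rightarrow> 'a::field_char_0"
  assumes "finite I" "inj_on x I"
  shows "(\<Sum>i\<in>I. \<Prod>j\<in>I-{i}. 1 - 1 / (x i - x j)) = of_nat (card I) \<and>
         (\<Sum>i\<in>I. x i * (\<Prod>j\<in>I-{i}. 1 - 1 / (x i - x j))) =
         (\<Sum>i\<in>I. x i) - of_nat (card I choose 2)"
  using assms
proof (induction I rule: finite_induct)
  case (insert w I)
  define c where "c i = (\<Prod>j\<in>I-{i}. 1 - 1 / (x i - x j))" for i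
  have xw: "x w \<notin> x ` I" and inj: "inj_on x I"
    using insert.prems insert.hyps by auto
  have split: "(\<Prod>j\<in>insert w I-{i}. 1 - 1 / (x i - x j)) = c i + c i / (x w - x i)" if "i \<in> I" for i
  proof -
    have "insert w I - {i} = insert w (I - {i})" using that insert.hyps by auto
    moreover have "1 / (x i - x w) = - (1 / (x w - x i))"
      by (metis minus_diff_eq minus_divide_right)
    ultimately show ?thesis using insert.hyps by (simp add: c_def algebra_simps)
  qed
  have cw: "(\<Prod>j\<in>I-{w}. 1 - 1 / (x w - x j)) = 1 - (\<Sum>i\<in>I. c i / (x w - x i))"
    using prod_partial_fractions[OF insert.hyps(1) inj xw] insert.hyps by (simp add: c_def)
  have IH: "(\<Sum>i\<in>I. c i) = of_nat (card I)"
           "(\<Sum>i\<in>I. x i * c i) = (\<Sum>i\<in>I. x i) - of_nat (card I choose 2)"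
    using insert.IH[OF inj] by (simp_all add: c_def)
  show ?case
  proof
    show "(\<Sum>i\<in>insert w I. \<Prod>j\<in>insert w I-{i}. 1 - 1 / (x i - x j)) = of_nat (card (insert w I))"
      using insert.hyps IH(1)
      by (simp add: split cw sum.distrib del: insert_Diff_if Diff_insert0 Diff_empty)
    \<comment> \<open>Writing \<open>x i\<close> as \<open>x w - (x w - x i)\<close> leaves a pole
      sum at \<open>x w\<close>, which cancels against the term of \<open>w\<close>, and the first
      identity.\<close>
    have "(\<Sum>i\<in>I. x i * (c i / (x w - x i))) = (\<Sum>i\<in>I. x w * (c i / (x w - x i)) - c i)"
    proof (rule sum.cong[OF refl])
      fix i assume "i \<in> I"
      then have "x w - x i \<noteq> 0" using xw by auto
      then show "x i * (c i / (x w - x i)) = x w * (c i / (x w - x i)) - c i"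
        by (simp add: divide_simps) (simp add: algebra_simps)
    qed
    then have Q: "(\<Sum>i\<in>I. x i * (c i / (x w - x i))) = x w * (\<Sum>i\<in>I. c i / (x w - x i)) - of_nat (card I)"
      using IH(1) by (simp add: sum_subtractf sum_distrib_left)
    have "Suc (card I) choose 2 = card I + (card I choose 2)"
      by (simp add: numeral_2_eq_2)
    moreover have "(\<Sum>i\<in>I. x i * (c i + c i / (x w - x i))) =
        (\<Sum>i\<in>I. x i) - of_nat (card I choose 2) + (x w * (\<Sum>i\<in>I. c i / (x w - x i)) - of_nat (card I))"
      unfolding distrib_left sum.distrib Q IH(2) ..
    ultimately show "(\<Sum>i\<in>insert w I. x i * (\<Prod>j\<in>insert w I-{i}. 1 - 1 / (x i - x j))) =
         (\<Sum>i\<in>insert w I. x i) - of_nat (card (insert w I) choose 2)"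
      using insert.hyps
      by (simp add: split cw right_diff_distrib del: insert_Diff_if Diff_insert0 Diff_empty)
  qed
qed (auto simp: binomial_eq_0)

section \<open>Divided differences and sums over subsets\<close>

text \<open>\<open>D h Z\<close> in the proof is the divided difference of \<open>h\<close> at the
  nodes \<open>Z\<close>. It annihilates polynomials of degree at most |Z| - 2, and the product over
  \<open>W\<close> is such a polynomial in \<open>u\<close>.\<close>

lemma sum_prod_over_differences_eq_0:
  fixes Z :: "'a::field set"
  assumes "finite W" "finite Z" "card W + 2 \<le> card Z"
  shows "(\<Sum>u\<in>Z. (\<Prod>w\<in>W. w - u) / (\<Prod>v\<in>Z-{u}. u - v)) = 0"
proof -
  define D where "D h Z = (\<Sum>u\<in>Z. h u / (\<Prod>v\<in>Z-{u}. u - v))" for h and Z :: "'a set"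
  \<comment> \<open>A linear factor that vanishes at a node deletes this node.\<close>
  have D_remove: "D (\<lambda>u. (u - z) * h u) Z = D h (Z - {z})" if "finite Z" "z \<in> Z" for h Z z
  proof -
    have "D (\<lambda>u. (u - z) * h u) Z = (\<Sum>u\<in>Z-{z}. (u - z) * h u / (\<Prod>v\<in>Z-{u}. u - v))"
      unfolding D_def using that by (subst sum.remove[of _ z]) auto
    also have "\<dots> = D h (Z - {z})"
      unfolding D_def
    proof (rule sum.cong[OF refl])
      fix u assume u: "u \<in> Z - {z}"
      then have "(\<Prod>v\<in>Z-{u}. u - v) = (u - z) * (\<Prod>v\<in>Z-{u}-{z}. u - v)"
        using that by (intro prod.remove) auto
      moreover have "Z - {u} - {z} = Z - {z} - {u}" by auto
      ultimately show "(u - z) * h u / (\<Prod>v\<in>Z-{u}. u - v) = h u / (\<Prod>v\<in>Z-{z}-{u}. u - v)"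
        using u by simp
    qed
    finally show ?thesis .
  qed
  have D_lin: "D (\<lambda>u. a * h u + b * g u) Z = a * D h Z + b * D g Z" for a b h g Z
    by (simp add: D_def sum.distrib sum_distrib_left add_divide_distrib)
  \<comment> \<open>Multiplication by \<open>z - z'\<close>, the difference of the linear factors of
    two nodes, reduces the claim to the equality of the values for \<open>Z\<close> without
    \<open>z\<close> and for \<open>Z\<close> without \<open>z'\<close>: both are 1 if there are two
    nodes, and 0 by induction otherwise.\<close>
  have base: "D (\<lambda>_. 1) Z = 0" if "2 \<le> card Z" for Z
    using that
  proof (induction "card Z" arbitrary: Z rule: less_induct)
    case less
    then have fin: "finite Z" by (metis card.infinite not_numeral_le_zero)
    obtain z z' where z: "z \<in> Z" "z' \<in> Z" "z \<noteq> z'"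
      using less.prems by (metis card_2_iff' card_le_Suc0_iff_eq fin not_less_eq_eq numeral_2_eq_2)
    have eq: "D (\<lambda>_. 1) (Z - {a}) = D (\<lambda>_. 1) (Z - {z})" if "a \<in> {z, z'}" for a
    proof (cases "card Z = 2")
      case True
      have "\<exists>b. Z - {y} = {b}" if "y \<in> Z" for y
        using True that fin by (simp add: card_1_singleton_iff[symmetric])
      moreover have "D (\<lambda>_. 1) {b} = 1" for b by (simp add: D_def)
      ultimately show ?thesis using that z by (metis insertE singletonD)
    next
      case False
      then have "D (\<lambda>_. 1) (Z - {y}) = 0" if "y \<in> Z" for y
        using less that fin by (intro less.hyps) (auto intro: card_Diff1_less)
      then show ?thesis using that z by (metis insertE singletonD)
    qed
    have "(z - z') * D (\<lambda>_. 1) Z = D (\<lambda>u. 1 * (u - z') + (-1) * (u - z)) Z"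
      by (simp add: D_def sum_distrib_left)
    also have "\<dots> = D (\<lambda>u. (u - z') * 1) Z - D (\<lambda>u. (u - z) * 1) Z"
      by (subst D_lin) simp
    also have "\<dots> = 0"
      unfolding D_remove[OF fin z(1)] D_remove[OF fin z(2)] using eq[of z'] by simp
    finally show ?case using z by simp
  qed
  have "D (\<lambda>u. \<Prod>w\<in>W. w - u) Z = 0"
    using assms
  proof (induction W arbitrary: Z rule: finite_induct)
    case empty
    then show ?case using base by simp
  next
    case (insert w W)
    then obtain z where z: "z \<in> Z" by force
    \<comment> \<open>With \<open>w - u\<close> written as \<open>(w - z) - (u - z)\<close>, the
      first part keeps all nodes and the second loses \<open>z\<close>; the induction hypothesis
      covers both.\<close>
    have "D (\<lambda>u. \<Prod>w\<in>insert w W. w - u) Z =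
          D (\<lambda>u. (w - z) * (\<Prod>w\<in>W. w - u) + (-1) * ((u - z) * (\<Prod>w\<in>W. w - u))) Z"
      using insert.hyps by (simp add: algebra_simps)
    also have "\<dots> = (w - z) * D (\<lambda>u. \<Prod>w\<in>W. w - u) Z - D (\<lambda>u. \<Prod>w\<in>W. w - u) (Z - {z})"
      by (subst D_lin) (simp add: D_remove[OF insert.prems(1) z])
    also have "\<dots> = 0"
      using insert z by simp
    finally show ?case .
  qed
  then show ?thesis by (simp add: D_def)
qed

text \<open>Double counting of the sets \<open>U\<close> with a marked element of
  \<open>U - A\<close>, which can be chosen in p - |A| > 0 ways. Removing the mark leaves a set of
  size p - 1; for a fixed remainder the sum over the marks is a divided difference of a polynomial
  of degree p - 1 at p + 1 nodes, hence 0.\<close>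

lemma sum_prod_cross_differences_eq_0:
  fixes X A :: "'a::field_char_0 set"
  assumes X: "finite X" "card X = 2 * p" and A: "A \<subseteq> X" "card A < p"
  shows "(\<Sum>U | A \<subseteq> U \<and> U \<subseteq> X \<and> card U = p. \<Prod>u\<in>U. \<Prod>v\<in>X-U. 1 / (u - v)) = 0"
proof -
  define F where "F U = (\<Prod>u\<in>U. \<Prod>v\<in>X-U. 1 / (u - v))" for U
  define S where "S = {U. A \<subseteq> U \<and> U \<subseteq> X \<and> card U = p}"
  define S' where "S' = {U. A \<subseteq> U \<and> U \<subseteq> X \<and> Suc (card U) = p}"
  have fin: "finite S" "finite S'" "\<And>U. U \<subseteq> X \<Longrightarrow> finite U"
    using X finite_subset by (auto simp: S_def S'_def intro: finite_subset[of _ "Pow X"])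
  \<comment> \<open>When \<open>u\<close> moves into the set, the factors 1/(u - v) appear and the
    factors 1/(w - u) disappear.\<close>
  have F_insert: "F (insert u U) =
      F U * ((\<Prod>w\<in>U. w - u) / (\<Prod>v\<in>X-U-{u}. u - v))" if "U \<in> S'" "u \<in> X - U" for U u
  proof -
    have U: "finite U" "u \<notin> U" using that fin by (auto simp: S'_def)
    have XU: "X - insert u U = X - U - {u}" by auto
    have "(\<Prod>w\<in>U. \<Prod>v\<in>X-U-{u}. 1 / (w - v)) = (\<Prod>w\<in>U. (\<Prod>v\<in>X-U. 1 / (w - v)) * (w - u))"
    proof (rule prod.cong[OF refl])
      fix w assume w: "w \<in> U"
      have "(\<Prod>v\<in>X-U. 1 / (w - v)) = 1 / (w - u) * (\<Prod>v\<in>X-U-{u}. 1 / (w - v))"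
        using that X by (intro prod.remove) auto
      then show "(\<Prod>v\<in>X-U-{u}. 1 / (w - v)) = (\<Prod>v\<in>X-U. 1 / (w - v)) * (w - u)"
        using w U by auto
    qed
    then have "F (insert u U) =
        (\<Prod>v\<in>X-U-{u}. 1 / (u - v)) * (\<Prod>w\<in>U. (\<Prod>v\<in>X-U. 1 / (w - v)) * (w - u))"
      unfolding F_def XU using U by simp
    also have "(\<Prod>w\<in>U. (\<Prod>v\<in>X-U. 1 / (w - v)) * (w - u)) = F U * (\<Prod>w\<in>U. w - u)"
      by (simp add: F_def prod.distrib)
    also have "(\<Prod>v\<in>X-U-{u}. 1 / (u - v)) = 1 / (\<Prod>v\<in>X-U-{u}. u - v)"
      by (simp add: prod_dividef)
    finally show ?thesis by simp
  qed
  have "of_nat (p - card A) * (\<Sum>U\<in>S. F U) = (\<Sum>U\<in>S. \<Sum>u\<in>U-A. F U)"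
  proof -
    have "card (U - A) = p - card A" if "U \<in> S" for U
      using that A X by (subst card_Diff_subset) (auto simp: S_def finite_subset)
    then show ?thesis by (simp add: sum_distrib_left)
  qed
  also have "\<dots> = (\<Sum>(U, u)\<in>(SIGMA U:S. U - A). F U)"
    using fin by (intro sum.Sigma) (auto simp: S_def)
  also have "\<dots> = (\<Sum>(U, u)\<in>(SIGMA U:S'. X - U). F (insert u U))"
    by (rule sum.reindex_bij_witness[of _ "\<lambda>(U, u). (insert u U, u)" "\<lambda>(U, u). (U - {u}, u)"])
       (use A fin in \<open>auto simp: S_def S'_def insert_absorb card_Suc_Diff1 card_insert_if\<close>)
  also have "\<dots> = (\<Sum>U\<in>S'. \<Sum>u\<in>X-U. F (insert u U))"
    using fin X by (intro sum.Sigma[symmetric]) auto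
  also have "\<dots> = (\<Sum>U\<in>S'. F U * (\<Sum>u\<in>X-U. (\<Prod>w\<in>U. w - u) / (\<Prod>v\<in>X-U-{u}. u - v)))"
    by (simp add: F_insert sum_distrib_left)
  also have "\<dots> = 0"
  proof (intro sum.neutral ballI)
    fix U assume "U \<in> S'"
    then have "(\<Sum>u\<in>X-U. (\<Prod>w\<in>U. w - u) / (\<Prod>v\<in>X-U-{u}. u - v)) = 0"
      using X fin by (intro sum_prod_over_differences_eq_0) (auto simp: S'_def card_Diff_subset)
    then show "F U * (\<Sum>u\<in>X-U. (\<Prod>w\<in>U. w - u) / (\<Prod>v\<in>X-U-{u}. u - v)) = 0" by simp
  qed
  finally show ?thesis using A by (simp add: F_def S_def)
qed

lemma signed_sum_prod_cross_differences:
  fixes E B :: "'a::field_char_0 set"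
  assumes "finite E" "finite B" "E \<inter> B = {}" "card E = p" "card B = p"
  shows "(\<Sum>U | U \<subseteq> E \<union> B \<and> card U = p. (-1) ^ card (U \<inter> B) * (\<Prod>u\<in>U. \<Prod>v\<in>(E \<union> B)-U. 1 / (u - v)))
         = (-2) ^ p * (\<Prod>u\<in>B. \<Prod>v\<in>E. 1 / (u - v))"
proof -
  define X where "X = E \<union> B"
  define F where "F U = (\<Prod>u\<in>U. \<Prod>v\<in>X-U. 1 / (u - v))" for U
  define S where "S = {U. U \<subseteq> X \<and> card U = p}"
  have X: "finite X" "card X = 2 * p"
    using assms by (simp_all add: X_def card_Un_disjoint)
  have finS: "finite S" using X by (auto simp: S_def intro: finite_subset[of _ "Pow X"])
  \<comment> \<open>Binomial expansion of a power of -2 + 1. Letting \<open>A\<close> range over all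
    of \<open>Pow B\<close>, with zero terms outside \<open>U\<close>, makes the range independent
    of \<open>U\<close>, so that the sums can be swapped.\<close>
  have sign: "(-1) ^ card (U \<inter> B) = (\<Sum>A\<in>Pow B. if A \<subseteq> U then (-2) ^ card A else (0::'a))" for U
  proof -
    have "(-1 :: 'a) ^ card (U \<inter> B) = (\<Prod>x\<in>U \<inter> B. (-2) + 1)" by simp
    also have "\<dots> = (\<Sum>A\<in>Pow (U \<inter> B). (-2) ^ card A)"
      using assms by (subst prod_add) auto
    also have "\<dots> = (\<Sum>A\<in>Pow B. if A \<subseteq> U then (-2) ^ card A else 0)"
      using assms by (intro sum.mono_neutral_cong_left) auto
    finally show ?thesis .
  qed
  have "(\<Sum>U\<in>S. (-1) ^ card (U \<inter> B) * F U) =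
        (\<Sum>A\<in>Pow B. \<Sum>U\<in>S. (if A \<subseteq> U then (-2) ^ card A else 0) * F U)"
    by (subst sum.swap) (simp add: sign sum_distrib_right)
  also have "\<dots> = (\<Sum>A\<in>Pow B. (-2) ^ card A * (\<Sum>U | A \<subseteq> U \<and> U \<subseteq> X \<and> card U = p. F U))"
  proof (rule sum.cong[OF refl])
    fix A
    have "(\<Sum>U\<in>S. (if A \<subseteq> U then (-2) ^ card A else 0) * F U) =
          (\<Sum>U | A \<subseteq> U \<and> U \<subseteq> X \<and> card U = p. (-2) ^ card A * F U)"
      using finS by (intro sum.mono_neutral_cong_right) (auto simp: S_def)
    then show "(\<Sum>U\<in>S. (if A \<subseteq> U then (-2) ^ card A else 0) * F U) =
          (-2) ^ card A * (\<Sum>U | A \<subseteq> U \<and> U \<subseteq> X \<and> card U = p. F U)"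
      by (simp add: sum_distrib_left)
  qed
  also have "\<dots> = (\<Sum>A\<in>{B}. (-2) ^ card A * (\<Sum>U | A \<subseteq> U \<and> U \<subseteq> X \<and> card U = p. F U))"
  proof (rule sum.mono_neutral_right)
    show "\<forall>A\<in>Pow B - {B}. (-2) ^ card A * (\<Sum>U | A \<subseteq> U \<and> U \<subseteq> X \<and> card U = p. F U) = 0"
    proof
      fix A assume A: "A \<in> Pow B - {B}"
      then have "card A < p" using assms psubset_card_mono[of B A] by auto
      then have "(\<Sum>U | A \<subseteq> U \<and> U \<subseteq> X \<and> card U = p. F U) = 0"
        unfolding F_def using A by (intro sum_prod_cross_differences_eq_0[OF X]) (auto simp: X_def)
      then show "(-2) ^ card A * (\<Sum>U | A \<subseteq> U \<and> U \<subseteq> X \<and> card U = p. F U) = 0" by simp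
    qed
  qed (use assms in auto)
  also have "\<dots> = (-2) ^ card B * (\<Sum>U | B \<subseteq> U \<and> U \<subseteq> X \<and> card U = p. F U)" by simp
  \<comment> \<open>A p-set that contains the p-set \<open>B\<close> is \<open>B\<close> itself, so
    a single product is left.\<close>
  also have "{U. B \<subseteq> U \<and> U \<subseteq> X \<and> card U = p} = {B}"
    using assms by (auto simp: X_def) (metis card_subset_eq finite_UnI rev_finite_subset subsetD)+
  also have "(\<Sum>U\<in>{B}. F U) = (\<Prod>u\<in>B. \<Prod>v\<in>E. 1 / (u - v))"
  proof -
    have "X - B = E" using assms by (auto simp: X_def)
    then show ?thesis by (simp add: F_def)
  qed
  finally show ?thesis using assms by (simp add: F_def S_def X_def)
qed

section \<open>Standard Young tableaux and the Frobenius formula\<close>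

lemma finite_young_diagram: "finite (young_diagram \<mu>)"
proof -
  have "young_diagram \<mu> = (SIGMA i:{..<length \<mu>}. {..<\<mu> ! i})"
    by (auto simp: young_diagram_def)
  then show ?thesis by simp
qed

lemma card_young_diagram: "card (young_diagram \<mu>) = sum_list \<mu>"
proof -
  have "young_diagram \<mu> = (SIGMA i:{..<length \<mu>}. {..<\<mu> ! i})"
    by (auto simp: young_diagram_def)
  then show ?thesis by (simp add: sum_list_sum_nth atLeast0LessThan)
qed

lemma finite_standard_young_tableaux: "finite (standard_young_tableaux \<mu>)"
proof (rule finite_subset)
  show "standard_young_tableaux \<mu> \<subseteq> (\<Pi>\<^sub>E c\<in>young_diagram \<mu>. {1..sum_list \<mu>})"
    by (auto simp: standard_young_tableaux_def PiE_def bij_betw_def)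
qed (simp add: finite_PiE finite_young_diagram)

lemma young_diagram_down_closed:
  assumes "sorted_wrt (\<ge>) \<mu>" "(i', j') \<in> young_diagram \<mu>" "i \<le> i'" "j \<le> j'"
  shows "(i, j) \<in> young_diagram \<mu>"
proof -
  have "\<mu> ! i' \<le> \<mu> ! i"
    using assms by (cases "i = i'") (auto simp: young_diagram_def sorted_wrt_iff_nth_less)
  then show ?thesis using assms by (auto simp: young_diagram_def)
qed

lemma standard_young_tableau_strict_mono:
  assumes "sorted_wrt (\<ge>) \<mu>" "T \<in> standard_young_tableaux \<mu>" "(i', j') \<in> young_diagram \<mu>"
    and "i \<le> i'" "j \<le> j'" "(i, j) \<noteq> (i', j')"
  shows "T (i, j) < T (i', j')"
proof -
  note D = young_diagram_down_closed[OF assms(1,3)]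
  have "T (i, j) < T (i, j')" if "j < j'"
    using assms(2) D[of i j] D[of i j'] assms(4,5) that by (auto simp: standard_young_tableaux_def)
  moreover have "T (i, j') < T (i', j')" if "i < i'"
    using assms(2) D[of i j'] D[of i' j'] assms(4,5) that by (auto simp: standard_young_tableaux_def)
  ultimately show ?thesis
    using assms(4-6) by (cases "i = i'"; cases "j = j'") force+
qed

section \<open>Corners and the branching rule\<close>

text \<open>Row \<open>i\<close> ends in a corner of the diagram. Parts may be 0: deleting a corner
  keeps the length of the list, so the number of beta numbers stays fixed in the Frobenius
  induction.\<close>

definition removable :: "nat list \<Rightarrow> nat \<Rightarrow> bool" where
  "removable \<mu> i \<longleftrightarrow> i < length \<mu> \<and> 0 < \<mu> ! i \<and> (Suc i < length \<mu> \<longrightarrow> \<mu> ! Suc i < \<mu> ! i)"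

lemma removable_sorted:
  assumes "sorted_wrt (\<ge>) \<mu>" "removable \<mu> i"
  shows "sorted_wrt (\<ge>) (\<mu>[i := \<mu> ! i - 1])"
  unfolding sorted_wrt_iff_nth_less
proof (intro allI impI)
  fix a b assume ab: "a < b" "b < length (\<mu>[i := \<mu> ! i - 1])"
  have sorted: "\<mu> ! b \<le> \<mu> ! a" if "a \<le> b" "b < length \<mu>" for a b
    using assms(1) that by (cases "a = b") (auto simp: sorted_wrt_iff_nth_less)
  show "\<mu>[i := \<mu> ! i - 1] ! b \<le> \<mu>[i := \<mu> ! i - 1] ! a"
  proof (cases "a = i")
    case True
    then have "\<mu> ! b \<le> \<mu> ! Suc i" using ab by (intro sorted) auto
    then show ?thesis using True ab assms(2) by (auto simp: removable_def)
  next
    case False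
    then show ?thesis using ab sorted[of a b] by (cases "b = i") auto
  qed
qed

lemma young_diagram_removable:
  assumes "removable \<mu> i"
  shows "(i, \<mu> ! i - 1) \<in> young_diagram \<mu>"
    and "young_diagram (\<mu>[i := \<mu> ! i - 1]) = young_diagram \<mu> - {(i, \<mu> ! i - 1)}"
  using assms by (auto simp: young_diagram_def removable_def nth_list_update split: if_splits)

lemma sum_list_removable:
  "removable \<mu> i \<Longrightarrow> sum_list (\<mu>[i := \<mu> ! i - 1]) = sum_list \<mu> - 1"
  by (metis card_Diff_singleton card_young_diagram young_diagram_removable)

lemma standard_young_tableau_max_cell:
  assumes "sorted_wrt (\<ge>) \<mu>" "T \<in> standard_young_tableaux \<mu>" "0 < sum_list \<mu>"
  shows "\<exists>i. removable \<mu> i \<and> T (i, \<mu> ! i - 1) = sum_list \<mu>"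
proof -
  let ?D = "young_diagram \<mu>"
  have bij: "bij_betw T ?D {1..sum_list \<mu>}"
    and row: "\<And>i j j'. (i, j) \<in> ?D \<Longrightarrow> (i, j') \<in> ?D \<Longrightarrow> j < j' \<Longrightarrow> T (i, j) < T (i, j')"
    and col: "\<And>i i' j. (i, j) \<in> ?D \<Longrightarrow> (i', j) \<in> ?D \<Longrightarrow> i < i' \<Longrightarrow> T (i, j) < T (i', j)"
    using assms(2) by (auto simp: standard_young_tableaux_def)
  have "sum_list \<mu> \<in> T ` ?D" using bij assms(3) by (simp add: bij_betw_def)
  then obtain i j where ij: "(i, j) \<in> ?D" "T (i, j) = sum_list \<mu>"
    by (metis imageE surj_pair)
  have le: "T c \<le> sum_list \<mu>" if "c \<in> ?D" for c
    using bij that by (auto simp: bij_betw_def)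
  have j: "j = \<mu> ! i - 1"
  proof (rule ccontr)
    assume "j \<noteq> \<mu> ! i - 1"
    then have "(i, Suc j) \<in> ?D" using ij by (auto simp: young_diagram_def)
    then show False using row[OF ij(1), of "Suc j"] le[of "(i, Suc j)"] ij by simp
  qed
  have "removable \<mu> i"
  proof (rule ccontr)
    assume "\<not> removable \<mu> i"
    then have "(Suc i, j) \<in> ?D" using ij j by (auto simp: young_diagram_def removable_def)
    then show False using col[OF ij(1), of "Suc i"] le[of "(Suc i, j)"] ij by simp
  qed
  then show ?thesis using ij j by auto
qed

text \<open>Deleting and restoring the cell of the maximal entry are inverse maps.\<close>

lemma card_tableaux_with_max_at:
  assumes sorted: "sorted_wrt (\<ge>) \<mu>" and rem: "removable \<mu> i"
  shows "card {T \<in> standard_young_tableaux \<mu>. T (i, \<mu> ! i - 1) = sum_list \<mu>}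
         = num_SYT (\<mu>[i := \<mu> ! i - 1])"
proof -
  let ?D = "young_diagram \<mu>" and ?c = "(i, \<mu> ! i - 1)" and ?\<nu> = "\<mu>[i := \<mu> ! i - 1]"
  let ?n = "sum_list \<mu>"
  note D = young_diagram_removable[OF rem]
  have n: "?n > 0" using rem member_le_sum_list[of "\<mu> ! i" \<mu>] by (auto simp: removable_def)
  have row_end: "j' \<noteq> \<mu> ! i - 1" if "(i, j) \<in> ?D" "j' < j" for j j'
    using that by (auto simp: young_diagram_def)
  have col_end: "i' = i" if "(i', \<mu> ! i - 1) \<in> ?D" "i \<le> i'" for i'
  proof (rule ccontr)
    assume "i' \<noteq> i"
    then have "\<mu> ! i' \<le> \<mu> ! Suc i" and "Suc i < length \<mu>"
      using that sorted sorted_wrt_iff_nth_less[of "(\<ge>)" \<mu>]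
      by (cases "i' = Suc i"; force simp: young_diagram_def)+
    then show False using that rem by (auto simp: removable_def young_diagram_def)
  qed
  have "bij_betw (\<lambda>T. restrict T (?D - {?c}))
          {T \<in> standard_young_tableaux \<mu>. T ?c = ?n} (standard_young_tableaux ?\<nu>)"
  proof (rule bij_betw_byWitness[where f' = "\<lambda>S. S(?c := ?n)"])
    show "\<forall>T\<in>{T \<in> standard_young_tableaux \<mu>. T ?c = ?n}. (restrict T (?D - {?c}))(?c := ?n) = T"
      by (auto simp: standard_young_tableaux_def extensional_def restrict_def fun_eq_iff)
    show "\<forall>S\<in>standard_young_tableaux ?\<nu>. restrict (S(?c := ?n)) (?D - {?c}) = S"
      unfolding standard_young_tableaux_def D(2) by (auto simp: extensional_def restrict_def fun_eq_iff)
    show "(\<lambda>T. restrict T (?D - {?c})) ` {T \<in> standard_young_tableaux \<mu>. T ?c = ?n}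
            \<subseteq> standard_young_tableaux ?\<nu>"
    proof safe
      fix T assume T: "T \<in> standard_young_tableaux \<mu>" "T ?c = ?n"
      then have "bij_betw T ?D {1..?n}" by (simp add: standard_young_tableaux_def)
      then have "bij_betw T (?D - {?c}) ({1..?n} - {?n})"
        using D(1) T(2) n by (intro bij_betw_DiffI) (auto simp: bij_betw_def)
      moreover have "{1..?n} - {?n} = {1..?n - 1}" using n by auto
      ultimately have "bij_betw (restrict T (?D - {?c})) (?D - {?c}) {1..?n - 1}"
        by (simp only: bij_betw_restrict_eq)
      then show "restrict T (?D - {?c}) \<in> standard_young_tableaux ?\<nu>"
        using T unfolding standard_young_tableaux_def D(2) sum_list_removable[OF rem] by auto
    qed
    show "(\<lambda>S. S(?c := ?n)) ` standard_young_tableaux ?\<nu>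
            \<subseteq> {T \<in> standard_young_tableaux \<mu>. T ?c = ?n}"
    proof safe
      fix S assume S: "S \<in> standard_young_tableaux ?\<nu>"
      have bij: "bij_betw S (?D - {?c}) {1..?n - 1}"
        using S unfolding standard_young_tableaux_def D(2) sum_list_removable[OF rem] by auto
      have lt: "S c < ?n" if "c \<in> ?D - {?c}" for c
        using bij_betwE[OF bij] that n by force
      have row: "S (a, j) < S (a, j')" if "(a, j) \<in> ?D - {?c}" "(a, j') \<in> ?D - {?c}" "j < j'" for a j j'
        using S that unfolding standard_young_tableaux_def D(2) by blast
      have col: "S (a, j) < S (a', j)" if "(a, j) \<in> ?D - {?c}" "(a', j) \<in> ?D - {?c}" "a < a'" for a a' j
        using S that unfolding standard_young_tableaux_def D(2) by blast
      have "bij_betw (S(?c := ?n)) (?D - {?c}) {1..?n - 1}"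
        using bij by (rule bij_betw_cong[THEN iffD1, rotated]) simp
      moreover have "bij_betw (S(?c := ?n)) {?c} {?n}" by (simp add: bij_betw_def)
      ultimately have "bij_betw (S(?c := ?n)) ((?D - {?c}) \<union> {?c}) ({1..?n - 1} \<union> {?n})"
        by (rule bij_betw_combine) (use n in auto)
      moreover have "(?D - {?c}) \<union> {?c} = ?D" "{1..?n - 1} \<union> {?n} = {1..?n}"
        using D(1) n by auto
      ultimately have "bij_betw (S(?c := ?n)) ?D {1..?n}" by simp
      moreover have "S(?c := ?n) \<in> extensional ?D"
        using S D unfolding standard_young_tableaux_def D(2) by (auto simp: extensional_def)
      moreover have "(S(?c := ?n)) (a, j) < (S(?c := ?n)) (a, j')"
        if "(a, j) \<in> ?D" "(a, j') \<in> ?D" "j < j'" for a j j'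
        using that row[of a j j'] lt[of "(a, j)"] row_end[of j' j] by auto
      moreover have "(S(?c := ?n)) (a, j) < (S(?c := ?n)) (a', j)"
        if "(a, j) \<in> ?D" "(a', j) \<in> ?D" "a < a'" for a a' j
        using that col[of a j a'] lt[of "(a, j)"] col_end[of a'] by auto
      ultimately show "S(?c := ?n) \<in> standard_young_tableaux \<mu>"
        by (auto simp: standard_young_tableaux_def)
    qed simp
  qed
  then show ?thesis by (simp add: num_SYT_def bij_betw_same_card)
qed

text \<open>Branching rule: the tableaux are sorted by the corner that holds the maximal
  entry.\<close>

lemma num_SYT_rec:
  assumes "sorted_wrt (\<ge>) \<mu>" "0 < sum_list \<mu>"
  shows "num_SYT \<mu> = (\<Sum>i | removable \<mu> i. num_SYT (\<mu>[i := \<mu> ! i - 1]))"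
proof -
  let ?S = "\<lambda>i. {T \<in> standard_young_tableaux \<mu>. T (i, \<mu> ! i - 1) = sum_list \<mu>}"
  have "standard_young_tableaux \<mu> = (\<Union>i\<in>{i. removable \<mu> i}. ?S i)"
    using standard_young_tableau_max_cell[OF assms(1) _ assms(2)] by blast
  moreover have "card (\<Union>i\<in>{i. removable \<mu> i}. ?S i) = (\<Sum>i | removable \<mu> i. card (?S i))"
  proof (rule card_UN_disjoint)
    show "finite {i. removable \<mu> i}"
      by (rule finite_subset[of _ "{..<length \<mu>}"]) (auto simp: removable_def)
    show "\<forall>i\<in>{i. removable \<mu> i}. \<forall>j\<in>{i. removable \<mu> i}. i \<noteq> j \<longrightarrow> ?S i \<inter> ?S j = {}"
    proof (intro ballI impI)
      fix i j assume ij: "i \<in> {i. removable \<mu> i}" "j \<in> {i. removable \<mu> i}" "i \<noteq> j"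
      have "False" if "T \<in> ?S i" "T \<in> ?S j" for T
      proof -
        have "inj_on T (young_diagram \<mu>)"
          using that by (auto simp: standard_young_tableaux_def bij_betw_def)
        then show False
          using that ij inj_onD[of T _ "(i, \<mu> ! i - 1)" "(j, \<mu> ! j - 1)"]
            young_diagram_removable(1)[of \<mu> i] young_diagram_removable(1)[of \<mu> j]
          by auto
      qed
      then show "?S i \<inter> ?S j = {}" by blast
    qed
  qed (simp add: finite_standard_young_tableaux)
  ultimately show ?thesis
    using card_tableaux_with_max_at[OF assms(1)] by (simp add: num_SYT_def)
qed

section \<open>Products of distances\<close>

lemma prod_abs_diff_lessThan:
  assumes "x < N"
  shows "(\<Prod>y\<in>{..<N}-{x}. \<bar>real x - real y\<bar>) = fact x * fact (N - 1 - x)"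
proof -
  have "{..<N} - {x} = {..<x} \<union> {Suc x..<N}" using assms by auto
  then have "(\<Prod>y\<in>{..<N}-{x}. \<bar>real x - real y\<bar>) =
      (\<Prod>y\<in>{..<x}. \<bar>real x - real y\<bar>) * (\<Prod>y\<in>{Suc x..<N}. \<bar>real x - real y\<bar>)"
    by (simp add: prod.union_disjoint disjoint_iff)
  also have "(\<Prod>y\<in>{..<x}. \<bar>real x - real y\<bar>) = (\<Prod>y\<in>{1..x}. real y)"
    by (rule prod.reindex_bij_witness[of _ "\<lambda>y. x - y" "\<lambda>y. x - y"]) auto
  also have "\<dots> = fact x" by (simp add: fact_prod)
  also have "(\<Prod>y\<in>{Suc x..<N}. \<bar>real x - real y\<bar>) = (\<Prod>y\<in>{1..N - 1 - x}. real y)"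
    by (rule prod.reindex_bij_witness[of _ "\<lambda>y. x + y" "\<lambda>y. y - x"]) (use assms in auto)
  also have "\<dots> = fact (N - 1 - x)" by (simp add: fact_prod)
  finally show ?thesis .
qed

text \<open>Ordered pairs are used, so this is the square of the absolute Vandermonde product, and
  the index set needs no order. The formulas below therefore take its square root.\<close>

definition diff_prod :: "('i \<Rightarrow> nat) \<Rightarrow> 'i set \<Rightarrow> real" where
  "diff_prod l I = (\<Prod>i\<in>I. \<Prod>j\<in>I-{i}. \<bar>real (l i) - real (l j)\<bar>)"

lemma diff_prod_lessThan: "diff_prod (\<lambda>i. i) {..<N} = (\<Prod>i<N. fact i)\<^sup>2"
proof -
  have "diff_prod (\<lambda>i. i) {..<N} = (\<Prod>i<N. fact i * fact (N - 1 - i))"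
    unfolding diff_prod_def by (intro prod.cong refl prod_abs_diff_lessThan) auto
  also have "\<dots> = (\<Prod>i<N. fact i) * (\<Prod>i<N. fact (N - 1 - i))"
    by (rule prod.distrib)
  also have "(\<Prod>i<N. fact (N - 1 - i) :: real) = (\<Prod>i<N. fact i)"
    by (rule prod.reindex_bij_witness[of _ "\<lambda>i. N - 1 - i" "\<lambda>i. N - 1 - i"]) auto
  finally show ?thesis by (simp add: power2_eq_square)
qed

lemma diff_prod_remove:
  assumes "finite I" "i \<in> I"
  shows "diff_prod l I = (\<Prod>j\<in>I-{i}. \<bar>real (l i) - real (l j)\<bar>)\<^sup>2 * diff_prod l (I - {i})"
proof -
  have "(\<Prod>a\<in>I-{i}. \<Prod>j\<in>I-{a}. \<bar>real (l a) - real (l j)\<bar>) =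
        (\<Prod>a\<in>I-{i}. \<bar>real (l i) - real (l a)\<bar> * (\<Prod>j\<in>I-{i}-{a}. \<bar>real (l a) - real (l j)\<bar>))"
  proof (rule prod.cong[OF refl])
    fix a assume a: "a \<in> I - {i}"
    then have "(\<Prod>j\<in>I-{a}. \<bar>real (l a) - real (l j)\<bar>) =
        \<bar>real (l a) - real (l i)\<bar> * (\<Prod>j\<in>I-{a}-{i}. \<bar>real (l a) - real (l j)\<bar>)"
      using assms by (intro prod.remove) auto
    moreover have "I - {a} - {i} = I - {i} - {a}" by auto
    ultimately show "(\<Prod>j\<in>I-{a}. \<bar>real (l a) - real (l j)\<bar>) =
        \<bar>real (l i) - real (l a)\<bar> * (\<Prod>j\<in>I-{i}-{a}. \<bar>real (l a) - real (l j)\<bar>)"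
      by (simp add: abs_minus_commute)
  qed
  then show ?thesis
    unfolding diff_prod_def prod.remove[OF assms] by (simp add: prod.distrib power2_eq_square)
qed

text \<open>Lowering \<open>l i\<close> by 1 multiplies its distance to \<open>l j\<close> by 1 -
  1/(l i - l j). This factor is non-negative because the values are distinct integers, so no
  absolute value remains.\<close>

lemma sqrt_diff_prod_shift:
  assumes "finite I" "i \<in> I" "inj_on l I" "0 < l i"
  shows "sqrt (diff_prod (l(i := l i - 1)) I) =
         sqrt (diff_prod l I) * (\<Prod>j\<in>I-{i}. 1 - 1 / (real (l i) - real (l j)))"
proof -
  let ?c = "\<lambda>j. 1 - 1 / (real (l i) - real (l j))"
  have c: "\<bar>real (l i - 1) - real (l j)\<bar> = \<bar>real (l i) - real (l j)\<bar> * ?c j \<and> 0 \<le> ?c j"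
    if "j \<in> I - {i}" for j
  proof -
    have "l i \<noteq> l j" using that assms by (auto dest: inj_onD)
    then consider "real (l j) + 1 \<le> real (l i)" | "real (l i) + 1 \<le> real (l j)" by linarith
    then show ?thesis
    proof cases
      case 1
      then show ?thesis using assms(4) by (simp add: field_simps of_nat_diff)
    next
      case 2
      then have "1 / (real (l i) - real (l j)) \<le> 0" by (simp add: divide_simps)
      moreover have "(real (l j) - real (l i)) / (real (l i) - real (l j)) = - 1"
        using 2 by (simp add: divide_simps)
      ultimately show ?thesis using 2 assms(4)
        by (simp add: right_diff_distrib of_nat_diff abs_if)
    qed
  qed
  have rest: "diff_prod (l(i := l i - 1)) (I - {i}) = diff_prod l (I - {i})"
    unfolding diff_prod_def by (auto intro!: prod.cong)
  have "(\<Prod>j\<in>I-{i}. \<bar>real ((l(i := l i - 1)) i) - real ((l(i := l i - 1)) j)\<bar>) =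
        (\<Prod>j\<in>I-{i}. \<bar>real (l i) - real (l j)\<bar> * ?c j)"
    by (intro prod.cong refl) (use c in auto)
  then have "diff_prod (l(i := l i - 1)) I = (\<Prod>j\<in>I-{i}. ?c j)\<^sup>2 * diff_prod l I"
    unfolding diff_prod_remove[OF assms(1,2)] rest by (simp add: prod.distrib power_mult_distrib)
  moreover have "(\<Prod>j\<in>I-{i}. ?c j) \<ge> 0" using c by (intro prod_nonneg) auto
  ultimately show ?thesis by (simp add: real_sqrt_mult)
qed

section \<open>Beta numbers and the Frobenius formula\<close>

text \<open>These are the hook lengths of the first column when all parts are positive. They turn a
  weakly decreasing list into distinct numbers, as the Vandermonde product requires.\<close>

definition beta_number :: "nat list \<Rightarrow> nat \<Rightarrow> nat" where
  "beta_number \<mu> i = \<mu> ! i + (length \<mu> - 1 - i)"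

lemma sum_beta_number:
  "(\<Sum>i<length \<mu>. real (beta_number \<mu> i)) = real (sum_list \<mu>) + real (length \<mu> choose 2)"
proof -
  have "(\<Sum>i<p. real (p - 1 - i)) = real (p choose 2)" for p
  proof -
    have "(\<Sum>i<p. p - 1 - i) = (\<Sum>i<p. i)"
      by (rule sum.reindex_bij_witness[of _ "\<lambda>i. p - 1 - i" "\<lambda>i. p - 1 - i"]) auto
    also have "\<dots> = p choose 2"
      by (induction p) (simp_all add: numeral_2_eq_2)
    finally have "real (\<Sum>i<p. p - 1 - i) = real (p choose 2)" by (rule arg_cong)
    then show ?thesis by simp
  qed
  then show ?thesis
    by (simp only: beta_number_def of_nat_add sum.distrib sum_list_sum_nth atLeast0LessThan of_nat_sum)
qed

lemma inj_on_beta_number: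
  assumes "sorted_wrt (\<ge>) \<mu>"
  shows "inj_on (beta_number \<mu>) {..<length \<mu>}"
proof (rule linorder_inj_onI)
  fix i j assume "i < j" "i \<in> {..<length \<mu>}" "j \<in> {..<length \<mu>}"
  then show "beta_number \<mu> i \<noteq> beta_number \<mu> j"
    using assms by (force simp: sorted_wrt_iff_nth_less beta_number_def)
qed auto

lemma diff_prod_reindex:
  assumes "bij_betw l I L"
  shows "diff_prod l I = diff_prod (\<lambda>x. x) L"
proof -
  have "(\<Prod>j\<in>I-{i}. \<bar>real (l i) - real (l j)\<bar>) = (\<Prod>y\<in>L-{l i}. \<bar>real (l i) - real y\<bar>)" if "i \<in> I" for i
    using assms that by (intro prod.reindex_bij_betw bij_betw_DiffI) (auto simp: bij_betw_def)
  then have "diff_prod l I = (\<Prod>i\<in>I. \<Prod>y\<in>L-{l i}. \<bar>real (l i) - real y\<bar>)"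
    unfolding diff_prod_def by (intro prod.cong refl)
  also have "\<dots> = diff_prod (\<lambda>x. x) L"
    unfolding diff_prod_def by (rule prod.reindex_bij_betw[OF assms])
  finally show ?thesis .
qed

text \<open>Induction on the size with the branching rule. Deleting the corner of row
  \<open>i\<close> lowers the \<open>i\<close>-th beta number by 1, so this corner contributes in
  proportion to the weight \<open>real (?l i) * ?c i\<close>; by \<open>sum_shift_quotients\<close>
  the weights add up to the size.\<close>

lemma frobenius_formula:
  assumes "sorted_wrt (\<ge>) \<mu>"
  shows "real (num_SYT \<mu>) * (\<Prod>i<length \<mu>. fact (beta_number \<mu> i)) =
         fact (sum_list \<mu>) * sqrt (diff_prod (beta_number \<mu>) {..<length \<mu>})"
  using assms
proof (induction "sum_list \<mu>" arbitrary: \<mu>)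
  case 0
  let ?p = "length \<mu>"
  have zero: "\<mu> ! i = 0" if "i < ?p" for i
    using that 0 by (metis nth_mem sum_list_eq_0_iff)
  then have D: "young_diagram \<mu> = {}" by (auto simp: young_diagram_def)
  have "standard_young_tableaux \<mu> = {\<lambda>_. undefined}"
    using 0(1) by (auto simp: standard_young_tableaux_def D bij_betw_def)
  then have num: "num_SYT \<mu> = 1" by (simp add: num_SYT_def)
  \<comment> \<open>For the empty partition the beta numbers are p - 1, ..., 0, and both sides are
    the product of their factorials.\<close>
  have beta: "beta_number \<mu> i = ?p - 1 - i" if "i < ?p" for i
    using zero that by (simp add: beta_number_def)
  have fact: "(\<Prod>i<?p. fact (beta_number \<mu> i) :: real) = (\<Prod>i<?p. fact i)"
    by (rule prod.reindex_bij_witness[of _ "\<lambda>i. ?p - 1 - i" "\<lambda>i. ?p - 1 - i"]) (auto simp: beta)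
  have "diff_prod (beta_number \<mu>) {..<?p} = diff_prod (\<lambda>i. i) {..<?p}"
    unfolding diff_prod_def by (intro prod.cong refl) (auto simp: beta)
  then show ?case using num fact by (simp add: 0(1)[symmetric] diff_prod_lessThan prod_nonneg)
next
  case (Suc n)
  let ?p = "length \<mu>" and ?l = "beta_number \<mu>"
  let ?c = "\<lambda>i. \<Prod>j\<in>{..<?p}-{i}. 1 - 1 / (real (?l i) - real (?l j))"
  let ?F = "(\<Prod>i<?p. fact (?l i)) :: real"
  note sorted = \<open>sorted_wrt (\<ge>) \<mu>\<close>
  note inj = inj_on_beta_number[OF sorted]
  have removable: "real (num_SYT (\<mu>[i := \<mu> ! i - 1])) * ?F =
      fact n * sqrt (diff_prod ?l {..<?p}) * (real (?l i) * ?c i)" if "removable \<mu> i" for i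
  proof -
    define \<nu> where "\<nu> = \<mu>[i := \<mu> ! i - 1]"
    have i: "i < ?p" "0 < \<mu> ! i" using that by (auto simp: removable_def)
    have beta: "beta_number \<nu> j = (?l(i := ?l i - 1)) j" if "j < ?p" for j
      using i that by (auto simp: beta_number_def nth_list_update \<nu>_def)
    have "?F = fact (?l i) * (\<Prod>j\<in>{..<?p}-{i}. fact (?l j))"
      using i by (intro prod.remove) auto
    moreover have "(\<Prod>j<?p. fact (beta_number \<nu> j) :: real) =
        fact (?l i - 1) * (\<Prod>j\<in>{..<?p}-{i}. fact (beta_number \<nu> j))"
      using i by (subst prod.remove[of _ i]) (auto simp: beta)
    moreover have "(\<Prod>j\<in>{..<?p}-{i}. fact (beta_number \<nu> j) :: real) = (\<Prod>j\<in>{..<?p}-{i}. fact (?l j))"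
      by (intro prod.cong refl) (auto simp: beta)
    moreover have "(fact (?l i) :: real) = real (?l i) * fact (?l i - 1)"
      using i by (intro fact_reduce) (auto simp: beta_number_def)
    ultimately have F: "?F = real (?l i) * (\<Prod>j<?p. fact (beta_number \<nu> j))" by simp
    have len: "length \<nu> = ?p" and sum: "sum_list \<nu> = n"
      using sum_list_removable[OF that] Suc.hyps(2) by (simp_all add: \<nu>_def)
    have "real (num_SYT \<nu>) * (\<Prod>j<length \<nu>. fact (beta_number \<nu> j)) =
        fact (sum_list \<nu>) * sqrt (diff_prod (beta_number \<nu>) {..<length \<nu>})"
      using sum sorted that unfolding \<nu>_def by (intro Suc.hyps(1) removable_sorted) auto
    also have "diff_prod (beta_number \<nu>) {..<length \<nu>} = diff_prod (?l(i := ?l i - 1)) {..<?p}"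
      unfolding diff_prod_def len
      by (rule prod.cong[OF refl], rule prod.cong[OF refl]) (simp add: beta)
    also have "sqrt \<dots> = sqrt (diff_prod ?l {..<?p}) * ?c i"
      using i inj by (intro sqrt_diff_prod_shift) (auto simp: beta_number_def)
    finally show ?thesis
      unfolding \<nu>_def [symmetric] F len sum by simp
  qed
  \<comment> \<open>Rows without a corner have weight 0: if the next row is equally long, its factor
    in \<open>?c i\<close> is 1 - 1/1; otherwise the row is last and empty, with beta number 0. So
    the sum may run over all rows.\<close>
  have not_removable: "real (?l i) * ?c i = 0" if "i < ?p" "\<not> removable \<mu> i" for i
  proof (cases "Suc i < ?p")
    case True
    then have "\<mu> ! Suc i \<le> \<mu> ! i" using sorted by (simp add: sorted_wrt_iff_nth_less)
    then have "\<mu> ! Suc i = \<mu> ! i" using that True by (auto simp: removable_def)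
    then have "real (?l i) - real (?l (Suc i)) = 1"
      using True by (simp add: beta_number_def)
    then show ?thesis using True by (auto intro!: prod_zero bexI[of _ "Suc i"])
  next
    case False
    then show ?thesis using that by (auto simp: removable_def beta_number_def)
  qed
  have "real (num_SYT \<mu>) * ?F = (\<Sum>i | removable \<mu> i. real (num_SYT (\<mu>[i := \<mu> ! i - 1])) * ?F)"
    using Suc.hyps(2) by (subst num_SYT_rec[OF sorted]) (simp_all add: sum_distrib_right)
  also have "\<dots> = (\<Sum>i | removable \<mu> i. fact n * sqrt (diff_prod ?l {..<?p}) * (real (?l i) * ?c i))"
    by (intro sum.cong refl removable) simp
  also have "\<dots> = (\<Sum>i<?p. fact n * sqrt (diff_prod ?l {..<?p}) * (real (?l i) * ?c i))"
    by (rule sum.mono_neutral_left) (use not_removable in \<open>auto simp: removable_def\<close>)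
  also have "\<dots> = fact n * sqrt (diff_prod ?l {..<?p}) * (\<Sum>i<?p. real (?l i) * ?c i)"
    by (simp add: sum_distrib_left)
  \<comment> \<open>The binomial correction cancels, since the beta numbers add up to the size plus
    the same binomial.\<close>
  also have "(\<Sum>i<?p. real (?l i) * ?c i) = real (Suc n)"
  proof -
    have "inj_on (\<lambda>i. real (?l i)) {..<?p}" using inj by (auto simp: inj_on_def)
    then show ?thesis
      using sum_shift_quotients[of "{..<?p}" "\<lambda>i. real (?l i)"] sum_beta_number[of \<mu>] Suc.hyps(2)
      by simp
  qed
  also have "fact n * sqrt (diff_prod ?l {..<?p}) * real (Suc n) =
             fact (sum_list \<mu>) * sqrt (diff_prod ?l {..<?p})"
    unfolding Suc.hyps(2)[symmetric] by simp
  finally show ?case .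
qed

section \<open>Hook products of rectangles\<close>

lemma fact_mult_prod_shift: "fact p * (\<Prod>j<n. real (j + p + 1)) = fact (p + n)"
proof (induction n)
  case (Suc n)
  have "(fact (p + Suc n) :: real) = real (n + p + 1) * fact (p + n)" by (simp add: algebra_simps)
  then show ?case by (simp add: Suc.IH [symmetric])
qed simp

text \<open>The beta numbers are the consecutive numbers q, ..., q + p - 1. So the Vandermonde
  product is that of 0, ..., p - 1, and (q + i)! is i! times the hook lengths of one row.\<close>

lemma num_SYT_rect_hook:
  "num_SYT (rect_shape p q) * (\<Prod>i<p. \<Prod>j<q. i + j + 1) = fact (p * q)"
proof -
  let ?\<mu> = "rect_shape p q"
  have sorted: "sorted_wrt (\<ge>) ?\<mu>" by (auto simp: rect_shape_def sorted_wrt_iff_nth_less)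
  have len: "length ?\<mu> = p" by (simp add: rect_shape_def)
  have beta: "beta_number ?\<mu> i = q + (p - 1 - i)" if "i < p" for i
    using that by (simp add: beta_number_def rect_shape_def)
  have "(\<Prod>i<p. fact (beta_number ?\<mu> i) :: real) = (\<Prod>i<p. fact (q + i))"
    by (rule prod.reindex_bij_witness[of _ "\<lambda>i. p - 1 - i" "\<lambda>i. p - 1 - i"]) (auto simp: beta)
  also have "\<dots> = (\<Prod>i<p. fact i * (\<Prod>j<q. real (i + j + 1)))"
  proof (rule prod.cong[OF refl])
    fix i
    show "(fact (q + i) :: real) = fact i * (\<Prod>j<q. real (i + j + 1))"
      using fact_mult_prod_shift[of i q] by (simp only: add.commute add.left_commute)
  qed
  also have "\<dots> = (\<Prod>i<p. fact i) * (\<Prod>i<p. \<Prod>j<q. real (i + j + 1))"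
    by (rule prod.distrib)
  finally have fact: "(\<Prod>i<p. fact (beta_number ?\<mu> i) :: real) = \<dots>" .
  have "diff_prod (beta_number ?\<mu>) {..<p} = diff_prod (\<lambda>i. i) {..<p}"
    unfolding diff_prod_def by (intro prod.cong refl) (auto simp: beta)
  then have "real (num_SYT ?\<mu>) * ((\<Prod>i<p. fact i) * (\<Prod>i<p. \<Prod>j<q. real (i + j + 1))) =
      fact (p * q) * (\<Prod>i<p. fact i)"
    using frobenius_formula[OF sorted] fact
    by (simp add: len diff_prod_lessThan prod_nonneg rect_shape_def sum_list_replicate)
  moreover have "(\<Prod>i<p. fact i :: real) \<noteq> 0" by simp
  ultimately have "real (num_SYT ?\<mu>) * (\<Prod>i<p. \<Prod>j<q. real (i + j + 1)) = fact (p * q)"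
    by (metis (no_types, lifting) mult.commute mult.left_commute mult_right_cancel)
  then have "real (num_SYT ?\<mu> * (\<Prod>i<p. \<Prod>j<q. i + j + 1)) = real (fact (p * q))"
    by simp
  then show ?thesis by (simp only: of_nat_eq_iff)
qed

section \<open>Summation over self-complementary half shapes\<close>

text \<open>Transport along an injective \<open>y\<close>: the sign refers to indices, later the odd
  ones, while the differences are those of the values.\<close>

lemma signed_sum_prod_cross_differences_indexed:
  fixes y :: "'i \<Rightarrow> 'a::field_char_0"
  assumes "finite I" "finite J" "I \<inter> J = {}" "card I = p" "card J = p" and inj: "inj_on y (I \<union> J)"
  shows "(\<Sum>U | U \<subseteq> I \<union> J \<and> card U = p. (-1) ^ card (U \<inter> J) * (\<Prod>u\<in>U. \<Prod>v\<in>(I \<union> J)-U. 1 / (y u - y v)))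
         = (-2) ^ p * (\<Prod>u\<in>J. \<Prod>v\<in>I. 1 / (y u - y v))"
proof -
  let ?X = "I \<union> J"
  have injI: "inj_on y I" and injJ: "inj_on y J" using inj by (auto simp: inj_on_Un)
  have disj: "y ` I \<inter> y ` J = {}" using inj assms(3) by (auto simp: inj_on_def)
  have bij: "bij_betw ((`) y) {U. U \<subseteq> ?X \<and> card U = p} {U. U \<subseteq> y ` I \<union> y ` J \<and> card U = p}"
    unfolding bij_betw_def
  proof
    show "inj_on ((`) y) {U. U \<subseteq> ?X \<and> card U = p}"
      using inj by (auto simp: inj_on_def inj_on_image_eq_iff[OF inj])
    show "(`) y ` {U. U \<subseteq> ?X \<and> card U = p} = {U. U \<subseteq> y ` I \<union> y ` J \<and> card U = p}"
    proof safe
      fix U assume "U \<subseteq> ?X" "p = card U"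
      then show "card (y ` U) = card U" by (meson card_image inj inj_on_subset)
    next
      fix U assume U: "U \<subseteq> y ` I \<union> y ` J" "p = card U"
      then obtain W where W: "W \<subseteq> ?X" "U = y ` W"
        by (metis image_Un subset_imageE)
      then have "card W = card U" by (metis card_image inj inj_on_subset)
      then show "U \<in> (`) y ` {W. W \<subseteq> ?X \<and> card W = card U}" using W by auto
    qed auto
  qed
  have summand: "(-1) ^ card (U \<inter> J) * (\<Prod>u\<in>U. \<Prod>v\<in>?X-U. 1 / (y u - y v)) =
      (-1) ^ card (y ` U \<inter> y ` J) * (\<Prod>u\<in>y ` U. \<Prod>v\<in>(y ` I \<union> y ` J) - y ` U. 1 / (u - v))"
    if "U \<subseteq> ?X" for U
  proof -
    have "y ` U \<inter> y ` J = y ` (U \<inter> J)"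
      using inj_on_image_Int[OF inj that, of J] by simp
    moreover have "card (y ` (U \<inter> J)) = card (U \<inter> J)"
      using inj by (intro card_image) (auto intro: inj_on_subset)
    moreover have "(y ` I \<union> y ` J) - y ` U = y ` (?X - U)"
      using inj_on_image_set_diff[OF inj, of ?X U] that by (simp add: image_Un)
    moreover have "(\<Prod>u\<in>y ` U. \<Prod>v\<in>y ` (?X - U). 1 / (u - v)) = (\<Prod>u\<in>U. \<Prod>v\<in>?X-U. 1 / (y u - y v))"
    proof -
      have "inj_on y U" "inj_on y (?X - U)" using inj that by (auto intro: inj_on_subset)
      then show ?thesis by (simp add: prod.reindex)
    qed
    ultimately show ?thesis by simp
  qed
  have "(\<Sum>U | U \<subseteq> ?X \<and> card U = p. (-1) ^ card (U \<inter> J) * (\<Prod>u\<in>U. \<Prod>v\<in>?X-U. 1 / (y u - y v))) =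
    (\<Sum>U | U \<subseteq> ?X \<and> card U = p. (-1) ^ card (y ` U \<inter> y ` J) * (\<Prod>u\<in>y ` U. \<Prod>v\<in>(y ` I \<union> y ` J) - y ` U. 1 / (u - v)))"
    by (intro sum.cong refl summand) auto
  also have "\<dots> = (\<Sum>U | U \<subseteq> y ` I \<union> y ` J \<and> card U = p.
      (-1) ^ card (U \<inter> y ` J) * (\<Prod>u\<in>U. \<Prod>v\<in>(y ` I \<union> y ` J) - U. 1 / (u - v)))"
    by (rule sum.reindex_bij_betw[OF bij])
  also have "\<dots> = (-2) ^ p * (\<Prod>u\<in>y ` J. \<Prod>v\<in>y ` I. 1 / (u - v))"
    using assms injI injJ disj by (intro signed_sum_prod_cross_differences) (auto simp: card_image)
  also have "(\<Prod>u\<in>y ` J. \<Prod>v\<in>y ` I. 1 / (u - v)) = (\<Prod>u\<in>J. \<Prod>v\<in>I. 1 / (y u - y v))"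
    using injI injJ by (simp add: prod.reindex)
  finally show ?thesis .
qed

section \<open>Signs of differences\<close>

text \<open>Each unordered pair contributes one factor 1 and one factor -1.\<close>

lemma prod_sgn_diff_all_pairs:
  assumes "finite U"
  shows "(\<Prod>u\<in>U. \<Prod>v\<in>U-{u}. sgn (real u - real v)) = (-1) ^ (card U choose 2)"
  using assms
proof (induction U rule: finite_induct)
  case (insert w U)
  have "(\<Prod>u\<in>U. \<Prod>v\<in>insert w U-{u}. sgn (real u - real v)) =
        (\<Prod>u\<in>U. sgn (real u - real w) * (\<Prod>v\<in>U-{u}. sgn (real u - real v)))"
  proof (rule prod.cong[OF refl])
    fix u assume "u \<in> U"
    then have "insert w U - {u} = insert w (U - {u})" using insert.hyps by auto
    then show "(\<Prod>v\<in>insert w U-{u}. sgn (real u - real v)) =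
        sgn (real u - real w) * (\<Prod>v\<in>U-{u}. sgn (real u - real v))"
      using insert.hyps by simp
  qed
  then have "(\<Prod>u\<in>insert w U. \<Prod>v\<in>insert w U-{u}. sgn (real u - real v)) =
      (\<Prod>v\<in>U. sgn (real w - real v) * sgn (real v - real w)) * (-1) ^ (card U choose 2)"
    using insert by (simp add: prod.distrib)
  also have "(\<Prod>v\<in>U. sgn (real w - real v) * sgn (real v - real w)) = (\<Prod>v\<in>U. -1)"
    using insert.hyps by (intro prod.cong refl) (auto simp: sgn_if)
  finally show ?case using insert.hyps by (simp add: numeral_2_eq_2 power_add)
qed (simp add: binomial_eq_0)

text \<open>For fixed \<open>u\<close> there are 2p - 1 - u larger numbers below 2p, so the signs
  over all \<open>v\<close> other than \<open>u\<close> multiply to -1 for even and to 1 for odd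
  \<open>u\<close>. The pairs inside \<open>U\<close> are then divided out by the previous
  lemma.\<close>

lemma prod_sgn_diff_cross:
  assumes "U \<subseteq> {..<2 * p}"
  shows "(\<Prod>u\<in>U. \<Prod>v\<in>{..<2 * p}-U. sgn (real u - real v)) =
         (-1) ^ (card U choose 2) * (-1) ^ card U * (-1) ^ card (U \<inter> {u. odd u})"
proof -
  have fin: "finite U" using assms finite_subset by blast
  have "(\<Prod>u\<in>U. \<Prod>v\<in>{..<2 * p}-{u}. sgn (real u - real v)) =
        (\<Prod>u\<in>U. (\<Prod>v\<in>U-{u}. sgn (real u - real v)) * (\<Prod>v\<in>{..<2 * p}-U. sgn (real u - real v)))"
  proof (rule prod.cong[OF refl])
    fix u assume "u \<in> U"
    then have "{..<2 * p} - {u} = (U - {u}) \<union> ({..<2 * p} - U)" using assms by auto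
    then show "(\<Prod>v\<in>{..<2 * p}-{u}. sgn (real u - real v)) =
       (\<Prod>v\<in>U-{u}. sgn (real u - real v)) * (\<Prod>v\<in>{..<2 * p}-U. sgn (real u - real v))"
      using fin by (simp add: prod.union_disjoint disjoint_iff)
  qed
  then have 1: "(\<Prod>u\<in>U. \<Prod>v\<in>{..<2 * p}-{u}. sgn (real u - real v)) =
      (-1) ^ (card U choose 2) * (\<Prod>u\<in>U. \<Prod>v\<in>{..<2 * p}-U. sgn (real u - real v))"
    by (simp add: prod.distrib prod_sgn_diff_all_pairs[OF fin])
  have "(\<Prod>v\<in>{..<2 * p}-{u}. sgn (real u - real v)) = (-1) * (if odd u then -1 else 1)" if "u \<in> U" for u
  proof -
    have u: "u < 2 * p" using that assms by auto
    then have "{..<2 * p} - {u} = {..<u} \<union> {Suc u..<2 * p}" by auto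
    then have "(\<Prod>v\<in>{..<2 * p}-{u}. sgn (real u - real v)) =
        (\<Prod>v\<in>{..<u}. 1) * (\<Prod>v\<in>{Suc u..<2 * p}. -1)"
      by (simp add: prod.union_disjoint disjoint_iff)
    also have "\<dots> = (-1) ^ (2 * p - Suc u)" by simp
    also have "\<dots> = (-1) * (if odd u then -1 else 1)"
      using u by (cases "odd u") auto
    finally show ?thesis .
  qed
  then have "(\<Prod>u\<in>U. \<Prod>v\<in>{..<2 * p}-{u}. sgn (real u - real v)) =
      (\<Prod>u\<in>U. (-1) * (if odd u then -1 else 1))"
    by (rule prod.cong[OF refl])
  also have "\<dots> = (-1) ^ card U * (\<Prod>u\<in>U \<inter> {u. odd u}. -1)"
    unfolding prod.distrib prod.inter_restrict[OF fin] by simp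
  finally have 2: "(\<Prod>u\<in>U. \<Prod>v\<in>{..<2 * p}-{u}. sgn (real u - real v)) =
      (-1) ^ card U * (-1) ^ card (U \<inter> {u. odd u})" by simp
  have "(-1 :: real) ^ n * (-1) ^ n = 1" for n by (simp add: power_mult_distrib[symmetric])
  then have "x = (-1) ^ n * ((-1) ^ n * x)" for x :: real and n
    by (simp add: mult.assoc [symmetric])
  from this[of _ "card U choose 2"] show ?thesis
    using 1 2 by (simp only: mult.assoc)
qed

lemma sum_prod_inverse_cross_distances:
  fixes y :: "nat \<Rightarrow> real"
  assumes mono: "strict_mono_on {..<2 * p} y"
  shows "(\<Sum>U | U \<subseteq> {..<2 * p} \<and> card U = p. \<Prod>u\<in>U. \<Prod>v\<in>{..<2 * p}-U. 1 / \<bar>y u - y v\<bar>)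
         = 2 ^ p * (\<Prod>i<p. \<Prod>j<p. 1 / \<bar>y (2 * i + 1) - y (2 * j)\<bar>)"
proof -
  define I J where "I = (\<lambda>i. 2 * i) ` {..<p}" and "J = (\<lambda>i. 2 * i + 1) ` {..<p}"
  have IJ: "I \<union> J = {..<2 * p}"
  proof (rule antisym)
    show "{..<2 * p} \<subseteq> I \<union> J"
    proof
      fix x assume "x \<in> {..<2 * p}"
      then show "x \<in> I \<union> J" by (cases "even x") (auto simp: I_def J_def elim!: evenE oddE)
    qed
  qed (auto simp: I_def J_def)
  have "I \<inter> J = {}" by (auto simp: I_def J_def) presburger
  have inj: "inj_on y (I \<union> J)" unfolding IJ using mono by (rule strict_mono_on_imp_inj_on)
  have card: "card I = p" "card J = p" by (simp_all add: I_def J_def card_image inj_on_def)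
  have UJ: "U \<inter> J = U \<inter> {u. odd u}" if "U \<subseteq> {..<2 * p}" for U
    using that by (auto simp: J_def elim!: oddE)
  define s where "s = ((-1) ^ (p choose 2) * (-1) ^ p :: real)"
  have s: "\<bar>s\<bar> = 1" by (simp add: s_def abs_mult power_abs)
  have abs: "(\<Prod>u\<in>U. \<Prod>v\<in>{..<2 * p}-U. 1 / \<bar>y u - y v\<bar>) =
      s * ((-1) ^ card (U \<inter> J) * (\<Prod>u\<in>U. \<Prod>v\<in>{..<2 * p}-U. 1 / (y u - y v)))"
    if U: "U \<subseteq> {..<2 * p}" "card U = p" for U
  proof -
    have "1 / \<bar>y u - y v\<bar> = sgn (real u - real v) * (1 / (y u - y v))"
      if "u \<in> U" "v \<in> {..<2 * p} - U" for u v
    proof -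
      have "u \<noteq> v" "u \<in> {..<2 * p}" "v \<in> {..<2 * p}" using that U by auto
      then show ?thesis
        using strict_mono_onD[OF mono, of u v] strict_mono_onD[OF mono, of v u]
        by (cases "u < v") (auto simp: abs_if divide_simps)
    qed
    then have "(\<Prod>u\<in>U. \<Prod>v\<in>{..<2 * p}-U. 1 / \<bar>y u - y v\<bar>) =
        (\<Prod>u\<in>U. \<Prod>v\<in>{..<2 * p}-U. sgn (real u - real v) * (1 / (y u - y v)))"
      by (intro prod.cong refl) auto
    also have "\<dots> = (\<Prod>u\<in>U. \<Prod>v\<in>{..<2 * p}-U. sgn (real u - real v)) *
        (\<Prod>u\<in>U. \<Prod>v\<in>{..<2 * p}-U. 1 / (y u - y v))"
      unfolding prod.distrib ..
    finally show ?thesis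
      unfolding prod_sgn_diff_cross[OF U(1)] by (simp add: s_def U UJ mult.assoc)
  qed
  have "(\<Sum>U | U \<subseteq> {..<2 * p} \<and> card U = p. \<Prod>u\<in>U. \<Prod>v\<in>{..<2 * p}-U. 1 / \<bar>y u - y v\<bar>)
     = s * (\<Sum>U | U \<subseteq> {..<2 * p} \<and> card U = p.
              (-1) ^ card (U \<inter> J) * (\<Prod>u\<in>U. \<Prod>v\<in>{..<2 * p}-U. 1 / (y u - y v)))"
    unfolding sum_distrib_left by (intro sum.cong refl abs) auto
  also have "\<dots> = s * ((-2) ^ p * (\<Prod>u\<in>J. \<Prod>v\<in>I. 1 / (y u - y v)))"
    using signed_sum_prod_cross_differences_indexed[of I J p y] \<open>I \<inter> J = {}\<close> card inj
    unfolding IJ by (simp add: I_def J_def)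
  also have "(\<Prod>u\<in>J. \<Prod>v\<in>I. 1 / (y u - y v)) = (\<Prod>i<p. \<Prod>j<p. 1 / (y (2 * i + 1) - y (2 * j)))"
    by (simp add: I_def J_def prod.reindex inj_on_def)
  finally have eq: "(\<Sum>U | U \<subseteq> {..<2 * p} \<and> card U = p. \<Prod>u\<in>U. \<Prod>v\<in>{..<2 * p}-U. 1 / \<bar>y u - y v\<bar>)
     = s * ((-2) ^ p * (\<Prod>i<p. \<Prod>j<p. 1 / (y (2 * i + 1) - y (2 * j))))" (is "?L = ?R") .
  \<comment> \<open>As the left side is non-negative, passing to absolute values removes
    \<open>s\<close> and the sign of (-2)^p.\<close>
  have "?L \<ge> 0" by (intro sum_nonneg prod_nonneg) auto
  then have "?L = \<bar>?R\<bar>" using eq by linarith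
  also have "\<dots> = 2 ^ p * (\<Prod>i<p. \<Prod>j<p. 1 / \<bar>y (2 * i + 1) - y (2 * j)\<bar>)"
    by (simp add: abs_mult s power_abs abs_prod)
  finally show ?thesis .
qed

text \<open>Induction adds a row and a column to both products. The new factors on the left are odd
  numbers; on the right they are p + 1, ..., 2p, twice, and 2p + 1, where the product of p + 1, ...,
  2p is 2^p times that of the first p odd numbers.\<close>

lemma prod_odd_differences:
  "2 ^ (p * p) * (\<Prod>i<p. \<Prod>j<p. \<bar>real (2 * i + 1) - real (2 * j)\<bar>) =
   2 ^ p * (\<Prod>i<p. \<Prod>j<p. real (i + j + 1))"
proof (induction p)
  case (Suc p)
  let ?d = "\<lambda>i j. \<bar>real (2 * i + 1) - real (2 * j)\<bar>" and ?h = "\<lambda>i j. real (i + j + 1)"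
  define A H B where "A = (\<Prod>i<p. \<Prod>j<p. ?d i j)" and "H = (\<Prod>i<p. \<Prod>j<p. ?h i j)"
    and "B = (\<Prod>j<p. real (2 * j + 1))"
  have double: "2 ^ p * (\<Prod>j<p. real (2 * j + 1)) * fact p = fact (2 * p)" for p :: nat
  proof (induction p)
    case (Suc p)
    have "(fact (2 * Suc p) :: real) = 2 * real (Suc p) * real (2 * p + 1) * fact (2 * p)"
      by (simp add: algebra_simps)
    then show ?case by (simp add: Suc.IH [symmetric])
  qed simp
  note fact_mult_prod_shift[of p p]
  then have "fact p * (\<Prod>j<p. ?h j p) = fact p * (2 ^ p * B)"
    using double[of p] unfolding B_def mult_2 by (simp only: mult.commute)
  then have half: "(\<Prod>j<p. ?h j p) = 2 ^ p * B" by simp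
  have row: "(\<Prod>j<Suc p. ?d p j) = (\<Prod>j<Suc p. real (2 * j + 1))"
    by (rule prod.reindex_bij_witness[of _ "\<lambda>j. p - j" "\<lambda>j. p - j"]) (auto simp: of_nat_diff)
  have col: "(\<Prod>i<p. ?d i p) = B" unfolding B_def
    by (rule prod.reindex_bij_witness[of _ "\<lambda>j. p - 1 - j" "\<lambda>j. p - 1 - j"]) (auto simp: of_nat_diff)
  have "(\<Prod>i<Suc p. \<Prod>j<Suc p. ?d i j) = A * (\<Prod>i<p. ?d i p) * (\<Prod>j<Suc p. ?d p j)"
    by (simp add: A_def prod.distrib)
  also have "\<dots> = A * B * (B * real (2 * p + 1))"
    unfolding row col by (simp add: B_def)
  finally have L: "(\<Prod>i<Suc p. \<Prod>j<Suc p. ?d i j) = A * B * (B * real (2 * p + 1))" .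
  have sym: "(\<Prod>j<p. ?h p j) = (\<Prod>j<p. ?h j p)" by (rule prod.cong) auto
  have "(\<Prod>j<Suc p. ?h p j) = (\<Prod>j<p. ?h p j) * real (2 * p + 1)"
    unfolding prod.lessThan_Suc mult_2 ..
  moreover have "(\<Prod>i<Suc p. \<Prod>j<Suc p. ?h i j) = H * (\<Prod>i<p. ?h i p) * (\<Prod>j<Suc p. ?h p j)"
    unfolding H_def prod.lessThan_Suc prod.distrib by (simp only: mult_ac)
  ultimately have R: "(\<Prod>i<Suc p. \<Prod>j<Suc p. ?h i j) = H * (2 ^ p * B) * (2 ^ p * B * real (2 * p + 1))"
    unfolding half sym by (simp only:)
  have "2 ^ (Suc p * Suc p) * (A * B * (B * real (2 * p + 1))) =
        (2 ^ (p * p) * A) * (2 * 2 ^ p * 2 ^ p * B * B * real (2 * p + 1))"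
    by (simp add: power_add)
  also have "2 ^ (p * p) * A = 2 ^ p * H" using Suc.IH by (simp add: A_def H_def)
  also have "2 ^ p * H * (2 * 2 ^ p * 2 ^ p * B * B * real (2 * p + 1)) =
      2 ^ Suc p * (H * (2 ^ p * B) * (2 ^ p * B * real (2 * p + 1)))"
    by simp
  finally show ?case unfolding L R .
qed simp

text \<open>The product x! (2k - 1 - x)! consists of the distances from x to all other numbers below
  2k. As \<open>L\<close> is closed under the reflection of x to 2k - 1 - x, the squared factorials
  over \<open>L\<close> become a product of distances, which is sorted by the parts
  \<open>L\<close>, \<open>C\<close> and \<open>M\<close> of the range. The values u(2k - 1 - u) are
  invariant under the reflection and have the differences (u - v)(2k - 1 - u - v).\<close>

lemma diff_prod_symmetric:
  fixes k p :: nat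
  assumes k: "k = 2 * p \<or> k = 2 * p + 1" and U: "U \<subseteq> {..<2 * p}"
  defines "L \<equiv> U \<union> (\<lambda>u. 2 * k - 1 - u) ` U"
  shows "(\<Prod>x\<in>L. fact x)\<^sup>2 = diff_prod (\<lambda>x. x) (L \<union> {2 * p..<k}) *
    (\<Prod>u\<in>U. \<Prod>v\<in>{..<2 * p}-U. \<bar>real u * (2 * real k - 1 - real u) - real v * (2 * real k - 1 - real v)\<bar>)\<^sup>2"
proof -
  define R where "R x = 2 * k - 1 - x" for x
  define V where "V = {..<2 * p} - U"
  define C where "C = V \<union> R ` V"
  \<comment> \<open>The middle part is empty for even \<open>k\<close> and consists of
    \<open>k - 1\<close> and \<open>k\<close> for odd \<open>k\<close>.\<close>
  define M where "M = {2 * p..<2 * k - 2 * p}"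
  have fin: "finite U" "finite V" using U finite_subset by (auto simp: V_def)
  have L: "L = U \<union> R ` U" by (auto simp: L_def R_def)
  have RR: "R (R x) = x" if "x < 2 * k" for x using that by (auto simp: R_def)
  have R_big: "2 * p \<le> R x" "2 * k - 2 * p \<le> R x" "R x < 2 * k" if "x < 2 * p" for x
    using that k by (auto simp: R_def)
  have lt: "x < 2 * k" if "x \<in> L" for x using that U k by (auto simp: L R_def)
  have R_bij: "bij_betw R L L"
    by (rule bij_betw_byWitness[where f' = R]) (use U k in \<open>auto simp: L R_def\<close>)
  have finL: "finite L" "finite C" "finite M" using fin by (auto simp: L C_def M_def)
  have small: "x < k" "x < 2 * p" if "x \<in> U \<union> V" for x using that U k by (auto simp: V_def)
  have prod_double: "(\<Prod>x\<in>W \<union> R ` W. h x) = (\<Prod>x\<in>W. h x * h (R x))"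
    if "W \<subseteq> {..<2 * p}" for W and h :: "nat \<Rightarrow> real"
  proof -
    have "inj_on R W" using that k by (auto simp: inj_on_def R_def)
    moreover have "R z \<notin> W" if "z \<in> W" for z
      using R_big(1)[of z] that \<open>W \<subseteq> {..<2 * p}\<close> by force
    then have "W \<inter> R ` W = {}" by auto
    moreover have "finite W" using that finite_subset by blast
    ultimately show ?thesis
      by (simp add: prod.union_disjoint prod.reindex prod.distrib)
  qed
  have RL: "(\<Prod>x\<in>L. h (R x)) = (\<Prod>x\<in>L. h x)" for h :: "nat \<Rightarrow> real"
    by (rule prod.reindex_bij_betw[OF R_bij])
  have fact_prod: "fact x * fact (R x) = (\<Prod>y\<in>L-{x}. \<bar>real x - real y\<bar>) *
      (\<Prod>y\<in>C. \<bar>real x - real y\<bar>) * (\<Prod>y\<in>M. \<bar>real x - real y\<bar>)" if "x \<in> L" for x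
  proof -
    have part: "{..<2 * k} = L \<union> C \<union> M" and disj: "L \<inter> C = {}" "(L \<union> C) \<inter> M = {}"
    proof -
      show "{..<2 * k} = L \<union> C \<union> M"
      proof
        show "{..<2 * k} \<subseteq> L \<union> C \<union> M"
        proof
          fix x assume x: "x \<in> {..<2 * k}"
          then have "x < 2 * p \<or> R x < 2 * p \<or> 2 * p \<le> x \<and> x < 2 * k - 2 * p"
            using k unfolding lessThan_iff R_def by arith
          then consider "x < 2 * p" | "R x < 2 * p" | "x \<in> M" by (auto simp: M_def)
          then show "x \<in> L \<union> C \<union> M"
          proof cases
            case 2
            then have "x = R (R x)" "R x \<in> U \<union> V" using RR x by (auto simp: V_def)
            then show ?thesis by (auto simp: L C_def)
          qed (auto simp: L C_def V_def)
        qed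
        show "L \<union> C \<union> M \<subseteq> {..<2 * k}" using U k by (auto simp: L C_def V_def M_def R_def)
      qed
      have "x \<notin> V \<union> R ` V" if "x \<in> U" for x
        using that small(2)[of x] R_big(1) by (fastforce simp: V_def)
      moreover have "R x \<notin> V \<union> R ` V" if "x \<in> U" for x
      proof -
        have "R x \<noteq> R v" if "v \<in> V" for v
          using RR[of x] RR[of v] small[of x] small[of v] \<open>x \<in> U\<close> that k by (force simp: V_def)
        then show ?thesis using that small(2)[of x] R_big(1)[of x] by (auto simp: V_def)
      qed
      ultimately show "L \<inter> C = {}" by (auto simp: L C_def)
      have "x \<notin> M \<and> R x \<notin> M" if "x \<in> U \<union> V" for x
        using small(2)[OF that] R_big(2)[of x] by (auto simp: M_def)
      then show "(L \<union> C) \<inter> M = {}" by (auto simp: L C_def)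
    qed
    have eq: "{..<2 * k} - {x} = (L - {x}) \<union> C \<union> M" using that disj part by auto
    have "fact x * fact (R x) = (\<Prod>y\<in>{..<2 * k}-{x}. \<bar>real x - real y\<bar>)"
      using prod_abs_diff_lessThan[OF lt[OF that]] by (simp add: R_def)
    also have "\<dots> = (\<Prod>y\<in>(L-{x}) \<union> C. \<bar>real x - real y\<bar>) * (\<Prod>y\<in>M. \<bar>real x - real y\<bar>)"
      unfolding eq using finL disj by (intro prod.union_disjoint) auto
    also have "(\<Prod>y\<in>(L-{x}) \<union> C. \<bar>real x - real y\<bar>) =
        (\<Prod>y\<in>L-{x}. \<bar>real x - real y\<bar>) * (\<Prod>y\<in>C. \<bar>real x - real y\<bar>)"
      using finL disj by (intro prod.union_disjoint) auto
    finally show ?thesis .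
  qed
  let ?y = "\<lambda>u. real u * (2 * real k - 1 - real u)"
  \<comment> \<open>Each pair \<open>u\<close>, \<open>v\<close> stands for four pairs, as either
    number may be replaced by its mirror image; the four distances multiply to the square of
    \<open>?y u - ?y v\<close>.\<close>
  have cross: "(\<Prod>x\<in>L. \<Prod>y\<in>C. \<bar>real x - real y\<bar>) = (\<Prod>u\<in>U. \<Prod>v\<in>V. \<bar>?y u - ?y v\<bar>)\<^sup>2"
  proof -
    have "(\<Prod>x\<in>L. \<Prod>y\<in>C. \<bar>real x - real y\<bar>) = (\<Prod>u\<in>U. \<Prod>v\<in>V.
      (\<bar>real u - real v\<bar> * \<bar>real u - real (R v)\<bar>) * (\<bar>real (R u) - real v\<bar> * \<bar>real (R u) - real (R v)\<bar>))"
      unfolding L C_def using U by (simp add: prod_double V_def prod.distrib)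
    also have "\<dots> = (\<Prod>u\<in>U. \<Prod>v\<in>V. \<bar>?y u - ?y v\<bar>\<^sup>2)"
    proof (intro prod.cong refl)
      fix u v assume "u \<in> U" "v \<in> V"
      then have R: "real (R u) = 2 * real k - 1 - real u" "real (R v) = 2 * real k - 1 - real v"
        using small[of u] small[of v] by (simp_all add: R_def of_nat_diff)
      have y: "?y u - ?y v = (real u - real v) * (2 * real k - 1 - real u - real v)"
        by (simp add: algebra_simps)
      have a: "\<bar>real u - real (R v)\<bar> = \<bar>2 * real k - 1 - real u - real v\<bar>"
        "\<bar>real (R u) - real v\<bar> = \<bar>2 * real k - 1 - real u - real v\<bar>"
        "\<bar>real (R u) - real (R v)\<bar> = \<bar>real u - real v\<bar>"
        unfolding R by linarith+
      show "(\<bar>real u - real v\<bar> * \<bar>real u - real (R v)\<bar>) * (\<bar>real (R u) - real v\<bar> * \<bar>real (R u) - real (R v)\<bar>)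
          = \<bar>?y u - ?y v\<bar>\<^sup>2"
        unfolding a y abs_mult power2_eq_square by (simp only: mult_ac)
    qed
    also have "\<dots> = (\<Prod>u\<in>U. \<Prod>v\<in>V. \<bar>?y u - ?y v\<bar>)\<^sup>2"
      by (simp only: prod_power_distrib)
    finally show ?thesis .
  qed
  have middle: "diff_prod (\<lambda>x. x) L * (\<Prod>x\<in>L. \<Prod>y\<in>M. \<bar>real x - real y\<bar>) =
      diff_prod (\<lambda>x. x) (L \<union> {2 * p..<k})"
    using k
  proof
    assume odd: "k = 2 * p + 1"
    then have sets: "M = {k - 1, k}" "{2 * p..<k} = {k - 1}" by (auto simp: M_def)
    have notin: "k - 1 \<notin> L" using odd U by (auto simp: L R_def)
    \<comment> \<open>The reflection exchanges \<open>k\<close> and \<open>k - 1\<close>, so the two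
      middle points together contribute a square, which is what the additional point
      \<open>k - 1\<close> adds to the Vandermonde product.\<close>
    have "(\<Prod>x\<in>L. \<bar>real x - real k\<bar>) = (\<Prod>x\<in>L. \<bar>real (R x) - real k\<bar>)"
      by (rule RL[symmetric])
    also have "\<dots> = (\<Prod>x\<in>L. \<bar>real (k - 1) - real x\<bar>)"
    proof (intro prod.cong refl)
      fix x assume "x \<in> L"
      then have "real (R x) = 2 * real k - 1 - real x" using lt[of x] by (simp add: R_def of_nat_diff)
      then show "\<bar>real (R x) - real k\<bar> = \<bar>real (k - 1) - real x\<bar>" using odd by simp
    qed
    finally have "(\<Prod>x\<in>L. \<Prod>y\<in>M. \<bar>real x - real y\<bar>) = (\<Prod>x\<in>L. \<bar>real (k - 1) - real x\<bar>)\<^sup>2"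
      using odd by (simp add: sets prod.distrib power2_eq_square abs_minus_commute)
    moreover have "diff_prod (\<lambda>x. x) (insert (k - 1) L) =
        (\<Prod>x\<in>L. \<bar>real (k - 1) - real x\<bar>)\<^sup>2 * diff_prod (\<lambda>x. x) L"
      using diff_prod_remove[of "insert (k - 1) L" "k - 1" "\<lambda>x. x"] finL notin by simp
    ultimately show ?thesis by (simp add: sets)
  qed (simp add: M_def)
  have "(\<Prod>x\<in>L. fact x :: real)\<^sup>2 = (\<Prod>x\<in>L. fact x * fact (R x))"
    using RL[of fact] by (simp add: prod.distrib power2_eq_square)
  also have "\<dots> = (\<Prod>x\<in>L. (\<Prod>y\<in>L-{x}. \<bar>real x - real y\<bar>) *
      (\<Prod>y\<in>C. \<bar>real x - real y\<bar>) * (\<Prod>y\<in>M. \<bar>real x - real y\<bar>))"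
    by (intro prod.cong refl fact_prod)
  also have "\<dots> = diff_prod (\<lambda>x. x) L * (\<Prod>x\<in>L. \<Prod>y\<in>M. \<bar>real x - real y\<bar>) *
      (\<Prod>x\<in>L. \<Prod>y\<in>C. \<bar>real x - real y\<bar>)"
    unfolding prod.distrib diff_prod_def by (simp only: mult_ac)
  finally show ?thesis unfolding middle cross V_def .
qed

section \<open>Half shapes and their tableau counts\<close>

locale half_subset =
  fixes k p :: nat and U :: "nat set"
  assumes k: "k = 2 * p \<or> k = 2 * p + 1" and U: "U \<subseteq> {..<2 * p}" "card U = p"
begin

text \<open>The number of non-elements of \<open>U\<close> below its \<open>i\<close>-th element.
  The gaps are the parts, in increasing order, of a partition inside a p x p square.\<close>

definition gap :: "nat \<Rightarrow> nat" where
  "gap i = sorted_list_of_set U ! i - i"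

text \<open>Rows \<open>i\<close> and \<open>k - 1 - i\<close> have lengths with sum
  \<open>k\<close>, apart from the middle row for odd \<open>k\<close>. So the shape and its image
  under rotation by 180 degrees tile the square, and only the central cell is left over for odd
  \<open>k\<close>.\<close>

definition shape :: "nat list" where
  "shape = map (\<lambda>i. if i < p then k - gap i else if i < k - p then p else gap (k - 1 - i)) [0..<k]"

lemma finite_U: "finite U"
  using U(1) finite_subset by blast

lemma enum_bij: "bij_betw (\<lambda>i. sorted_list_of_set U ! i) {..<p} U"
  using bij_betw_nth[of "sorted_list_of_set U" "{..<p}" U] U(2) finite_U by simp

lemma enum_add_le: "j < p \<Longrightarrow> i \<le> j \<Longrightarrow> sorted_list_of_set U ! i + (j - i) \<le> sorted_list_of_set U ! j"
proof (induction j)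
  case (Suc j)
  have "sorted_list_of_set U ! j < sorted_list_of_set U ! Suc j"
    using Suc.prems(1) U(2) finite_U strict_sorted_list_of_set[of U]
    by (simp add: sorted_wrt_iff_nth_less)
  then show ?case using Suc by (cases "i = Suc j") (auto simp: le_Suc_eq)
qed simp

lemma enum_eq: "i < p \<Longrightarrow> sorted_list_of_set U ! i = i + gap i"
  using enum_add_le[of i 0] by (simp add: gap_def)

lemma gap_mono: "i \<le> j \<Longrightarrow> j < p \<Longrightarrow> gap i \<le> gap j"
  using enum_add_le[of j i] enum_eq[of i] enum_eq[of j] by simp

lemma gap_le: "i < p \<Longrightarrow> gap i \<le> p"
proof -
  assume i: "i < p"
  have "sorted_list_of_set U ! (p - 1) < 2 * p"
    using bij_betwE[OF enum_bij] U(1) i by force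
  moreover have "sorted_list_of_set U ! i + (p - 1 - i) \<le> sorted_list_of_set U ! (p - 1)"
    using i by (intro enum_add_le) auto
  ultimately show ?thesis using enum_eq[OF i] i by linarith
qed

lemma length_shape: "length shape = k"
  by (simp add: shape_def)

lemma nth_shape:
  "i < p \<Longrightarrow> shape ! i = k - gap i"
  "p \<le> i \<Longrightarrow> i < k - p \<Longrightarrow> shape ! i = p"
  "k - p \<le> i \<Longrightarrow> i < k \<Longrightarrow> shape ! i = gap (k - 1 - i)"
proof -
  have "p \<le> k - p" "k - p \<le> k" using k by auto
  then show "i < p \<Longrightarrow> shape ! i = k - gap i" "p \<le> i \<Longrightarrow> i < k - p \<Longrightarrow> shape ! i = p"
    "k - p \<le> i \<Longrightarrow> i < k \<Longrightarrow> shape ! i = gap (k - 1 - i)"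
    by (auto simp: shape_def)
qed

lemma sorted_shape: "sorted_wrt (\<ge>) shape"
  unfolding sorted_wrt_iff_nth_less length_shape
proof (intro allI impI)
  fix i j assume ij: "i < j" "j < k"
  have mirror: "k - 1 - x < p" if "k - p \<le> x" "x < k" for x using that by arith
  consider "j < p" | "i < p" "p \<le> j" "j < k - p" | "i < p" "k - p \<le> j"
    | "p \<le> i" "i < k - p" "k - p \<le> j" | "k - p \<le> i"
    using ij k by force
  then show "shape ! j \<le> shape ! i"
  proof cases
    case 1
    then show ?thesis using ij gap_mono[of i j] by (simp add: nth_shape)
  next
    case 2
    then show ?thesis using gap_le[of i] k by (auto simp: nth_shape)
  next
    case 3
    then show ?thesis using gap_le[of i] gap_le[OF mirror, of j] k ij by (auto simp: nth_shape)
  next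
    case 4
    then show ?thesis using gap_le[OF mirror, of j] ij by (simp add: nth_shape)
  next
    case 5
    then show ?thesis using gap_mono[OF _ mirror[of i], of "k - 1 - j"] ij by (simp add: nth_shape)
  qed
qed

lemma sum_list_shape: "sum_list shape = 2 * (p * (k - p))"
proof -
  have "sum_list shape = (\<Sum>i<k. shape ! i)"
    by (simp add: sum_list_sum_nth length_shape atLeast0LessThan)
  also have "{..<k} = {..<p} \<union> {p..<k-p} \<union> {k-p..<k}" using k by auto
  also have "sum ((!) shape) \<dots> = (\<Sum>i<p. shape ! i) + (\<Sum>i=p..<k-p. shape ! i) + (\<Sum>i=k-p..<k. shape ! i)"
    using k by (subst sum.union_disjoint; (subst sum.union_disjoint)?) auto
  also have "(\<Sum>i<p. shape ! i) = (\<Sum>i<p. k - gap i)"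
    by (simp add: nth_shape)
  also have "(\<Sum>i=p..<k-p. shape ! i) = (k - 2 * p) * p"
    by (simp add: nth_shape mult_2)
  also have "(\<Sum>i=k-p..<k. shape ! i) = (\<Sum>i<p. gap i)"
    by (rule sum.reindex_bij_witness[of _ "\<lambda>i. k - 1 - i" "\<lambda>i. k - 1 - i"])
       (use k in \<open>auto simp: nth_shape\<close>)
  finally have "sum_list shape = (\<Sum>i<p. k - gap i) + (\<Sum>i<p. gap i) + (k - 2 * p) * p" by simp
  also have "(\<Sum>i<p. k - gap i) + (\<Sum>i<p. gap i) = (\<Sum>i<p. k)"
    unfolding sum.distrib[symmetric] using gap_le k by (intro sum.cong refl) fastforce
  also have "(\<Sum>i<p. k) + (k - 2 * p) * p = 2 * (p * (k - p))"
    using k by (auto simp: algebra_simps)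
  finally show ?thesis .
qed

text \<open>A gap plus its index is an element of \<open>U\<close>. So the lower rows carry
  \<open>U\<close>, the upper rows its mirror image, and the middle row the point 2p: the
  configuration of \<open>diff_prod_symmetric\<close>.\<close>

lemma beta_shape:
  "i < p \<Longrightarrow> beta_number shape i = 2 * k - 1 - sorted_list_of_set U ! i"
  "p \<le> i \<Longrightarrow> i < k - p \<Longrightarrow> beta_number shape i = 2 * p"
  "i < p \<Longrightarrow> beta_number shape (k - 1 - i) = sorted_list_of_set U ! i"
proof -
  show "beta_number shape i = 2 * k - 1 - sorted_list_of_set U ! i" if "i < p"
    using gap_le[OF that] k that
    by (auto simp: beta_number_def length_shape nth_shape enum_eq)
  show "beta_number shape i = 2 * p" if "p \<le> i" "i < k - p"
    using k that by (auto simp: beta_number_def length_shape nth_shape)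
  show "beta_number shape (k - 1 - i) = sorted_list_of_set U ! i" if "i < p"
  proof -
    have "k - 1 - (k - 1 - i) = i" "k - p \<le> k - 1 - i" "k - 1 - i < k" using that k by auto
    then show ?thesis by (simp add: beta_number_def length_shape nth_shape(3) enum_eq that)
  qed
qed

lemma bij_betw_beta_shape:
  "bij_betw (beta_number shape) {..<k} (U \<union> (\<lambda>u. 2 * k - 1 - u) ` U \<union> {2 * p..<k})"
proof -
  have "{..<k} = {..<p} \<union> {p..<k-p} \<union> (\<lambda>i. k - 1 - i) ` {..<p}"
  proof
    show "{..<k} \<subseteq> {..<p} \<union> {p..<k-p} \<union> (\<lambda>i. k - 1 - i) ` {..<p}"
    proof
      fix x assume "x \<in> {..<k}"
      then have "x = k - 1 - (k - 1 - x)" "x < k" by auto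
      then have "x \<in> (\<lambda>i. k - 1 - i) ` {..<p}" if "k - p \<le> x"
        using that by (intro image_eqI[of _ _ "k - 1 - x"]) auto
      then show "x \<in> {..<p} \<union> {p..<k-p} \<union> (\<lambda>i. k - 1 - i) ` {..<p}"
        by (cases "x < k - p") auto
    qed
  qed (use k in auto)
  then have "beta_number shape ` {..<k} = beta_number shape ` {..<p} \<union> beta_number shape ` {p..<k-p}
      \<union> (\<lambda>i. beta_number shape (k - 1 - i)) ` {..<p}"
    by (simp add: image_Un image_image)
  also have "beta_number shape ` {..<p} = (\<lambda>i. 2 * k - 1 - sorted_list_of_set U ! i) ` {..<p}"
    by (intro image_cong refl) (simp add: beta_shape)
  also have "\<dots> = (\<lambda>u. 2 * k - 1 - u) ` (\<lambda>i. sorted_list_of_set U ! i) ` {..<p}"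
    by (simp add: image_image)
  also have "(\<lambda>i. beta_number shape (k - 1 - i)) ` {..<p} = (\<lambda>i. sorted_list_of_set U ! i) ` {..<p}"
    by (rule image_cong[OF refl], rule beta_shape(3)) simp
  also have "(\<lambda>i. sorted_list_of_set U ! i) ` {..<p} = U" by (rule bij_betw_imp_surj_on[OF enum_bij])
  also have "beta_number shape ` {p..<k-p} = (\<lambda>i. 2 * p) ` {p..<k-p}"
    by (intro image_cong refl) (simp add: beta_shape)
  also have "\<dots> = {2 * p..<k}" using k by auto
  finally have "beta_number shape ` {..<k} = U \<union> (\<lambda>u. 2 * k - 1 - u) ` U \<union> {2 * p..<k}" by auto
  then show ?thesis
    using inj_on_beta_number[OF sorted_shape] by (simp add: bij_betw_def length_shape)
qed

text \<open>By \<open>diff_prod_symmetric\<close> the factorials over \<open>U\<close> and its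
  mirror image cancel in the Frobenius formula against the Vandermonde product, up to the cross
  product. For odd \<open>k\<close> the middle beta number leaves a factor (2p)!.\<close>

lemma num_SYT_shape:
  "real (num_SYT shape) * fact (2 * p) ^ (k - 2 * p) *
     (\<Prod>u\<in>U. \<Prod>v\<in>{..<2 * p}-U. \<bar>real u * (2 * real k - 1 - real u) - real v * (2 * real k - 1 - real v)\<bar>)
   = fact (2 * (p * (k - p)))"
proof -
  let ?L = "U \<union> (\<lambda>u. 2 * k - 1 - u) ` U" and ?M = "{2 * p..<k}"
  let ?G = "\<Prod>u\<in>U. \<Prod>v\<in>{..<2 * p}-U. \<bar>real u * (2 * real k - 1 - real u) - real v * (2 * real k - 1 - real v)\<bar>"
  define P where "P = (\<Prod>x\<in>?L. fact x :: real)"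
  have P: "P > 0" by (simp add: P_def prod_pos)
  have G: "?G \<ge> 0" by (intro prod_nonneg) auto
  have "P\<^sup>2 = diff_prod (\<lambda>x. x) (?L \<union> ?M) * ?G\<^sup>2"
    unfolding P_def by (rule diff_prod_symmetric[OF k U(1)])
  then have "sqrt (P\<^sup>2) = sqrt (diff_prod (\<lambda>x. x) (?L \<union> ?M)) * sqrt (?G\<^sup>2)"
    by (simp add: real_sqrt_mult)
  then have PG: "P = sqrt (diff_prod (\<lambda>x. x) (?L \<union> ?M)) * ?G"
    using P G by simp
  have "?L \<inter> ?M = {}" using U(1) k by auto
  then have "(\<Prod>x\<in>?L \<union> ?M. fact x :: real) = P * (\<Prod>x\<in>?M. fact x)"
    unfolding P_def using finite_U by (intro prod.union_disjoint) auto
  also have "(\<Prod>x\<in>?M. fact x :: real) = fact (2 * p) ^ (k - 2 * p)"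
    using k by (auto simp: atLeastLessThanSuc)
  finally have "(\<Prod>i<k. fact (beta_number shape i) :: real) = P * fact (2 * p) ^ (k - 2 * p)"
    using prod.reindex_bij_betw[OF bij_betw_beta_shape, of "fact :: nat \<Rightarrow> real"] by simp
  then have "real (num_SYT shape) * (P * fact (2 * p) ^ (k - 2 * p)) =
      fact (2 * (p * (k - p))) * sqrt (diff_prod (\<lambda>x. x) (?L \<union> ?M))"
    using frobenius_formula[OF sorted_shape]
    by (simp add: length_shape sum_list_shape diff_prod_reindex[OF bij_betw_beta_shape])
  then have "real (num_SYT shape) * (P * fact (2 * p) ^ (k - 2 * p)) * ?G =
      fact (2 * (p * (k - p))) * (sqrt (diff_prod (\<lambda>x. x) (?L \<union> ?M)) * ?G)"
    by (simp only: mult.assoc)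
  also have "\<dots> = fact (2 * (p * (k - p))) * P" by (simp only: PG [symmetric])
  finally show ?thesis using P by simp
qed

end

section \<open>Closed form of the sum over half shapes\<close>

text \<open>The range lies to the left of the vertex k - 1/2 of the parabola a(2k - 1 - a).\<close>

lemma strict_mono_on_symmetric_product:
  assumes "2 * p \<le> k"
  shows "strict_mono_on {..<2 * p} (\<lambda>a. real a * (2 * real k - 1 - real a))"
proof (rule strict_mono_onI)
  fix a b :: nat assume ab: "a \<in> {..<2 * p}" "b \<in> {..<2 * p}" "a < b"
  have "a + b + 1 < 2 * k" using ab assms unfolding lessThan_iff by arith
  then have "real (a + b + 1) < real (2 * k)" by (simp only: of_nat_less_iff)
  then have "0 < (real b - real a) * (2 * real k - 1 - real a - real b)"
    using ab(3) by (intro mult_pos_pos) auto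
  then show "real a * (2 * real k - 1 - real a) < real b * (2 * real k - 1 - real b)"
    by (simp add: algebra_simps)
qed

text \<open>Read backwards in both indices, the second product has the factors k - 2p + i + j + 1.
  For even \<open>k\<close> the two products coincide. For odd \<open>k\<close> they are the hook
  product of a p x (p + 1) rectangle without its last and without its first column, and (2p)!
  supplies both missing columns.\<close>

lemma prod_hooks_factor:
  assumes "k = 2 * p \<or> k = 2 * p + 1"
  shows "(\<Prod>i<p. \<Prod>j<p. real (i + j + 1)) * (\<Prod>i<p. \<Prod>j<p. real (k - 1 - i - j)) * fact (2 * p) ^ (k - 2 * p)
         = (\<Prod>i<p. \<Prod>j<k-p. real (i + j + 1))\<^sup>2"
proof -
  have "(\<Prod>j<p. real (k - 1 - i - j)) = (\<Prod>j<p. real (k - 2 * p + (p - 1 - i) + j + 1))" if "i < p" for i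
    by (rule prod.reindex_bij_witness[of _ "\<lambda>j. p - 1 - j" "\<lambda>j. p - 1 - j"]) (use that assms in auto)
  then have "(\<Prod>i<p. \<Prod>j<p. real (k - 1 - i - j)) = (\<Prod>i<p. \<Prod>j<p. real (k - 2 * p + (p - 1 - i) + j + 1))"
    by (rule prod.cong[OF refl]) (simp only: lessThan_iff)
  also have "\<dots> = (\<Prod>i<p. \<Prod>j<p. real (k - 2 * p + i + j + 1))"
    by (rule prod.reindex_bij_witness[of _ "\<lambda>j. p - 1 - j" "\<lambda>j. p - 1 - j"]) auto
  finally have rev: "(\<Prod>i<p. \<Prod>j<p. real (k - 1 - i - j)) = \<dots>" .
  show ?thesis using assms
  proof
    assume "k = 2 * p"
    then show ?thesis unfolding rev by (simp add: power2_eq_square)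
  next
    assume k: "k = 2 * p + 1"
    define H Q H' where "H = (\<Prod>i<p. \<Prod>j<p. real (i + j + 1))" and "Q = (\<Prod>i<p. real (i + p + 1))"
      and "H' = (\<Prod>i<p. \<Prod>j<p. real (i + Suc j + 1))"
    have 1: "(\<Prod>i<p. \<Prod>j<Suc p. real (i + j + 1)) = H * Q"
      by (simp add: H_def Q_def prod.distrib)
    have 2: "(\<Prod>i<p. \<Prod>j<Suc p. real (i + j + 1)) = fact p * H'"
      unfolding prod.lessThan_Suc_shift prod.distrib H'_def by (simp add: fact_prod_Suc atLeast0LessThan)
    note fact_mult_prod_shift[of p p]
    then have 3: "(fact (2 * p) :: real) = fact p * Q" by (simp only: mult_2 Q_def)
    have 4: "(\<Prod>i<p. \<Prod>j<p. real (1 + i + j + 1)) = H'"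
      by (simp add: H'_def)
    have 5: "k - p = Suc p" "k - 2 * p = 1" using k by auto
    have "H * H' * fact (2 * p) ^ 1 = (H * Q) * (fact p * H')"
      unfolding 3 power_one_right by (simp only: mult_ac)
    then show ?thesis
      unfolding rev 5 4 H_def [symmetric] power2_eq_square 1 [symmetric] 2 [symmetric] .
  qed
qed

text \<open>The half shapes are counted by inverse products of distances of the \<open>y a\<close>,
  so \<open>sum_prod_inverse_cross_distances\<close> evaluates the sum as (2m)!/H^2 with m = p(k -
  p). The hook formula H = m!/f turns this into the binomial times f^2.\<close>

lemma sum_num_SYT_half_shapes:
  assumes k: "k = 2 * p \<or> k = 2 * p + 1"
  shows "(\<Sum>U | U \<subseteq> {..<2 * p} \<and> card U = p. num_SYT (half_subset.shape k p U)) =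
         (2 * (p * (k - p)) choose (p * (k - p))) * num_SYT (rect_shape p (k - p)) ^ 2"
proof -
  let ?n = "2 * (p * (k - p))" and ?m = "p * (k - p)"
  define y where "y a = real a * (2 * real k - 1 - real a)" for a :: nat
  define f where "f = num_SYT (rect_shape p (k - p))"
  define H where "H = (\<Prod>i<p. \<Prod>j<k-p. real (i + j + 1))"
  define N :: real where "N = fact (2 * p) ^ (k - 2 * p)"
  have pos: "H > 0" "N > 0" by (auto simp: H_def N_def intro!: prod_pos)
  have mono: "strict_mono_on {..<2 * p} y"
    unfolding y_def using k by (intro strict_mono_on_symmetric_product) auto
  have shape: "real (num_SYT (half_subset.shape k p U)) =
      fact ?n / N * (\<Prod>u\<in>U. \<Prod>v\<in>{..<2 * p}-U. 1 / \<bar>y u - y v\<bar>)"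
    if "U \<subseteq> {..<2 * p}" "card U = p" for U
  proof -
    interpret half_subset k p U by standard (use k that in auto)
    have "(\<Prod>u\<in>U. \<Prod>v\<in>{..<2 * p}-U. \<bar>y u - y v\<bar>) \<noteq> 0"
      using inj_onD[OF strict_mono_on_imp_inj_on[OF mono]] that finite_U by (auto simp: subset_iff)
    moreover have "real (num_SYT shape) * N * (\<Prod>u\<in>U. \<Prod>v\<in>{..<2 * p}-U. \<bar>y u - y v\<bar>) = fact ?n"
      unfolding N_def y_def by (rule num_SYT_shape)
    ultimately show ?thesis
      using pos by (simp add: prod_dividef field_simps)
  qed
  \<comment> \<open>In the difference of \<open>y (2 * i + 1)\<close> and \<open>y (2 * j)\<close>
    the second factor 2k - 2 - 2i - 2j is even. These factors 2 turn the odd differences into hook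
    lengths by \<open>prod_odd_differences\<close>.\<close>
  define \<Delta> where "\<Delta> = (\<Prod>i<p. \<Prod>j<p. \<bar>y (2 * i + 1) - y (2 * j)\<bar>)"
  have "\<Delta> = (\<Prod>i<p. \<Prod>j<p. \<bar>real (2 * i + 1) - real (2 * j)\<bar> * (2 * real (k - 1 - i - j)))"
    unfolding \<Delta>_def
  proof (intro prod.cong refl)
    fix i j assume "i \<in> {..<p}" "j \<in> {..<p}"
    then have "i + j + 1 \<le> k" using k by auto
    then have d: "real (k - 1 - i - j) = real k - 1 - real i - real j" by (simp add: of_nat_diff)
    have "y (2 * i + 1) - y (2 * j) = (real (2 * i + 1) - real (2 * j)) * (2 * real (k - 1 - i - j))"
      unfolding d y_def by (simp add: algebra_simps)
    then show "\<bar>y (2 * i + 1) - y (2 * j)\<bar> = \<bar>real (2 * i + 1) - real (2 * j)\<bar> * (2 * real (k - 1 - i - j))"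
      by (simp add: abs_mult)
  qed
  also have "\<dots> = (2 ^ (p * p) * (\<Prod>i<p. \<Prod>j<p. \<bar>real (2 * i + 1) - real (2 * j)\<bar>)) *
      (\<Prod>i<p. \<Prod>j<p. real (k - 1 - i - j))"
    by (simp add: prod.distrib power_mult)
  also have "\<dots> = 2 ^ p * ((\<Prod>i<p. \<Prod>j<p. real (i + j + 1)) * (\<Prod>i<p. \<Prod>j<p. real (k - 1 - i - j)))"
    unfolding prod_odd_differences by (simp only: mult.assoc)
  finally have \<Delta>: "\<Delta> * N = 2 ^ p * H\<^sup>2"
    using prod_hooks_factor[OF k] by (simp add: H_def N_def)
  then have "\<Delta> \<noteq> 0" using pos by auto
  then have "1 / \<Delta> = N / (2 ^ p * H\<^sup>2)"
    using pos \<Delta> by (simp add: field_simps)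
  then have D: "(\<Prod>i<p. \<Prod>j<p. 1 / \<bar>y (2 * i + 1) - y (2 * j)\<bar>) = N / (2 ^ p * H\<^sup>2)"
    by (simp add: prod_dividef \<Delta>_def)
  have "real (\<Sum>U | U \<subseteq> {..<2 * p} \<and> card U = p. num_SYT (half_subset.shape k p U)) =
      (\<Sum>U | U \<subseteq> {..<2 * p} \<and> card U = p. fact ?n / N * (\<Prod>u\<in>U. \<Prod>v\<in>{..<2 * p}-U. 1 / \<bar>y u - y v\<bar>))"
    unfolding of_nat_sum by (intro sum.cong refl shape) auto
  also have "\<dots> = fact ?n / N * (2 ^ p * (N / (2 ^ p * H\<^sup>2)))"
    unfolding sum_distrib_left [symmetric] sum_prod_inverse_cross_distances[OF mono] D ..
  also have "\<dots> = fact ?n / H\<^sup>2" using pos by simp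
  also have "\<dots> = real (?n choose ?m) * real f ^ 2"
  proof -
    have "f * (\<Prod>i<p. \<Prod>j<k-p. i + j + 1) = fact ?m"
      unfolding f_def by (rule num_SYT_rect_hook)
    then have "real (f * (\<Prod>i<p. \<Prod>j<k-p. i + j + 1)) = fact ?m" by simp
    then have f: "real f * H = fact ?m" by (simp add: H_def)
    have "fact ?m * fact (?n - ?m) * (?n choose ?m) = fact ?n" by (rule binomial_fact_lemma) simp
    then have "fact ?m * fact ?m * (?n choose ?m) = (fact ?n :: nat)" by (simp add: mult_2)
    then have "real (fact ?m * fact ?m * (?n choose ?m)) = real (fact ?n)" by (rule arg_cong)
    then have "(fact ?n :: real) = (real f * H) * (real f * H) * real (?n choose ?m)"
      unfolding f by simp
    then show ?thesis using pos by (simp add: power2_eq_square)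
  qed
  finally have "real (\<Sum>U | U \<subseteq> {..<2 * p} \<and> card U = p. num_SYT (half_subset.shape k p U)) =
      real ((?n choose ?m) * f ^ 2)" by simp
  then show ?thesis unfolding of_nat_eq_iff f_def .
qed

section \<open>Self-complementary square tableaux\<close>

text \<open>The fixed points of Schuetzenberger's evacuation, which on rectangles is rotation by 180
  degrees with complementation of the entries.\<close>

definition self_complementary_tableaux :: "nat \<Rightarrow> (nat \<times> nat \<Rightarrow> nat) set" where
  "self_complementary_tableaux k = {T \<in> standard_young_tableaux (rect_shape k k).
     \<forall>i<k. \<forall>j<k. T (i, j) + T (k - 1 - i, k - 1 - j) = k\<^sup>2 + 1}"

lemma young_diagram_rect: "young_diagram (rect_shape p q) = {..<p} \<times> {..<q}"
  by (auto simp: young_diagram_def rect_shape_def)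

lemma sorted_rect_shape: "sorted_wrt (\<ge>) (rect_shape p q)"
  by (auto simp: rect_shape_def sorted_wrt_iff_nth_less)

lemma standard_young_tableaux_rectI:
  assumes "T \<in> extensional ({..<p} \<times> {..<q})" "bij_betw T ({..<p} \<times> {..<q}) {1..p * q}"
    and "\<And>i j i' j'. i \<le> i' \<Longrightarrow> j \<le> j' \<Longrightarrow> i' < p \<Longrightarrow> j' < q \<Longrightarrow> (i, j) \<noteq> (i', j') \<Longrightarrow> T (i, j) < T (i', j')"
  shows "T \<in> standard_young_tableaux (rect_shape p q)"
  using assms unfolding standard_young_tableaux_def young_diagram_rect
  by (auto simp: rect_shape_def sum_list_replicate)

section \<open>Completing a tableau of a half shape to the square\<close>

context half_subset
begin

lemma square_parity: "k\<^sup>2 = 2 * sum_list shape + (k - 2 * p)"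
  using k by (auto simp: sum_list_shape power2_eq_square algebra_simps)

lemma diagram_subset: "young_diagram shape \<subseteq> {..<k} \<times> {..<k}"
proof
  fix c assume "c \<in> young_diagram shape"
  then obtain i j where c: "c = (i, j)" "i < k" "j < shape ! i"
    by (auto simp: young_diagram_def length_shape)
  consider "i < p" | "p \<le> i" "i < k - p" | "k - p \<le> i" by linarith
  then have "shape ! i \<le> k"
  proof cases
    case 3
    then have "k - 1 - i < p" using c by arith
    then have "gap (k - 1 - i) \<le> p" by (rule gap_le)
    then show ?thesis using 3 c k by (auto simp: nth_shape)
  qed (use k in \<open>auto simp: nth_shape\<close>)
  then show "c \<in> {..<k} \<times> {..<k}" using c by auto
qed

lemma middle_row: "p < k - p \<Longrightarrow> (p, j) \<in> young_diagram shape \<longleftrightarrow> j < p"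
  by (auto simp: young_diagram_def length_shape nth_shape)

text \<open>Opposite rows have complementary lengths. The condition \<open>p < k - p\<close>
  expresses that \<open>k\<close> is odd; then the central cell is its own image and has to be
  excluded.\<close>

lemma diagram_rotate:
  assumes "i < k" "j < k" "(i, j) \<noteq> (p, p) \<or> \<not> p < k - p"
  shows "(k - 1 - i, k - 1 - j) \<in> young_diagram shape \<longleftrightarrow> (i, j) \<notin> young_diagram shape"
proof -
  consider "i < p" | "p \<le> i" "i < k - p" | "k - p \<le> i" by linarith
  then show ?thesis
  proof cases
    case 1
    then have "k - p \<le> k - 1 - i" "k - 1 - (k - 1 - i) = i" using k by auto
    then show ?thesis using 1 assms gap_le[OF 1]
      by (auto simp: young_diagram_def length_shape nth_shape)
  next
    case 2
    then have i: "i = p" "k - 1 - i = p" "p < k - p" and "k - 1 = 2 * p" using k by auto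
    then have "k - 1 - j < p \<longleftrightarrow> \<not> j < p" using assms 2 by auto
    then show ?thesis unfolding i(2) unfolding i(1) by (simp add: middle_row[OF i(3)])
  next
    case 3
    then have i: "k - 1 - i < p" using assms by arith
    then show ?thesis using 3 assms gap_le[OF i] k
      by (auto simp: young_diagram_def length_shape nth_shape)
  qed
qed

text \<open>The last case occurs only for odd \<open>k\<close>, at the central cell.\<close>

definition complete :: "(nat \<times> nat \<Rightarrow> nat) \<Rightarrow> nat \<times> nat \<Rightarrow> nat" where
  "complete S = (\<lambda>(i, j)\<in>{..<k} \<times> {..<k}.
     if (i, j) \<in> young_diagram shape then S (i, j)
     else if (k - 1 - i, k - 1 - j) \<in> young_diagram shape then k\<^sup>2 + 1 - S (k - 1 - i, k - 1 - j)
     else sum_list shape + 1)"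

lemma complete_in_diagram: "c \<in> young_diagram shape \<Longrightarrow> complete S c = S c"
  using diagram_subset by (auto simp: complete_def split: prod.splits)

text \<open>With n the size of the half shape, the shape holds 1, ..., n, its rotated image the
  complements, and the central cell, if left over, the middle value n + 1. The second claim recovers
  the half shape from the completed tableau.\<close>

lemma complete_self_complementary:
  assumes S: "S \<in> standard_young_tableaux shape"
  shows "complete S \<in> self_complementary_tableaux k"
    and "\<And>c. c \<in> {..<k} \<times> {..<k} \<Longrightarrow> complete S c \<le> sum_list shape \<longleftrightarrow> c \<in> young_diagram shape"
proof -
  let ?D = "young_diagram shape" and ?n = "sum_list shape"
  define rot where "rot = (\<lambda>(i, j). (k - 1 - i, k - 1 - j))"
  define T where "T = complete S"
  have bijS: "bij_betw S ?D {1..?n}" using S by (simp add: standard_young_tableaux_def)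
  have S_range: "1 \<le> S c" "S c \<le> ?n" if "c \<in> ?D" for c
    using bij_betwE[OF bijS] that by auto
  have n: "2 * ?n \<le> k\<^sup>2" "k\<^sup>2 \<le> 2 * ?n + 1" using square_parity k by auto
  have rot_cell: "rot c \<in> {..<k} \<times> {..<k}" "rot (rot c) = c" if "c \<in> {..<k} \<times> {..<k}" for c
    using that by (auto simp: rot_def)
  \<comment> \<open>A cell lies in the half shape, in its rotated image, or in the center for odd
    \<open>k\<close>. All later case distinctions rest on this.\<close>
  have kind: "(c \<in> ?D \<and> rot c \<notin> ?D) \<or> (c \<notin> ?D \<and> rot c \<in> ?D) \<or>
      (c = (p, p) \<and> rot c = (p, p) \<and> p < k - p \<and> c \<notin> ?D)"
    if "c \<in> {..<k} \<times> {..<k}" for c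
  proof (cases "c = (p, p) \<and> p < k - p")
    case True
    then have "k - 1 - p = p" using k by auto
    then show ?thesis using True middle_row[of p] by (simp add: rot_def)
  next
    case False
    then show ?thesis
      using diagram_rotate[of "fst c" "snd c"] that by (auto simp: rot_def)
  qed
  have T_in: "T c = S c" if "c \<in> ?D" for c
    using that by (simp add: T_def complete_in_diagram)
  have T_rot: "T c = k\<^sup>2 + 1 - S (rot c)" if "rot c \<in> ?D" "c \<in> {..<k} \<times> {..<k}" for c
    using that kind[of c]
    by (auto simp: T_def complete_def rot_def split: prod.splits)
  have T_centre: "T (p, p) = ?n + 1" if "p < k - p"
  proof -
    have "k - Suc p = p" "p < k" "(p, p) \<notin> ?D" using that k middle_row[of p] by auto
    then show ?thesis by (simp add: T_def complete_def)
  qed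
  have odd_square: "k\<^sup>2 = 2 * ?n + 1" if "p < k - p"
  proof -
    have "k - 2 * p = 1" using that k by auto
    then show ?thesis using square_parity by simp
  qed
  have mono: "T (i, j) < T (i', j')"
    if le: "i \<le> i'" "j \<le> j'" and cell: "i' < k" "j' < k" and ne: "(i, j) \<noteq> (i', j')" for i j i' j'
  proof -
    let ?c = "(i, j)" and ?c' = "(i', j')"
    have cells: "?c \<in> {..<k} \<times> {..<k}" "?c' \<in> {..<k} \<times> {..<k}" using le cell by auto
    have down: "?c \<in> ?D" if "?c' \<in> ?D"
      using young_diagram_down_closed[OF sorted_shape that le] .
    have up: "rot ?c' \<in> ?D" if "rot ?c \<in> ?D"
      using young_diagram_down_closed[OF sorted_shape, of "k - 1 - i" "k - 1 - j" "k - 1 - i'" "k - 1 - j'"]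
        that le by (simp add: rot_def)
    \<comment> \<open>Other combinations are impossible: the half shape is closed downwards
      (\<open>down\<close>), its rotated image upwards (\<open>up\<close>), and there is only one
      central cell.\<close>
    consider "?c \<in> ?D" "?c' \<in> ?D" | "?c \<in> ?D" "rot ?c' \<in> ?D" | "rot ?c \<in> ?D" "rot ?c' \<in> ?D"
      | "?c \<in> ?D" "?c' = (p, p)" "p < k - p" | "?c = (p, p)" "rot ?c' \<in> ?D" "p < k - p"
      using kind[OF cells(1)] kind[OF cells(2)] down up ne by metis
    then show ?thesis
    proof cases
      case 1
      then show ?thesis
        using standard_young_tableau_strict_mono[OF sorted_shape S 1(2) le ne] by (simp add: T_in)
    next
      case 2
      then show ?thesis
        using T_in[of ?c] T_rot[of ?c'] cells S_range[of ?c] S_range[of "rot ?c'"] n by simp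
    next
      case 3
      have "S (k - 1 - i', k - 1 - j') < S (k - 1 - i, k - 1 - j)"
        using 3 le ne cell
        by (intro standard_young_tableau_strict_mono[OF sorted_shape S]) (auto simp: rot_def)
      then have "S (rot ?c') < S (rot ?c)" by (simp add: rot_def)
      then show ?thesis
        using T_rot[OF 3(1) cells(1)] T_rot[OF 3(2) cells(2)] S_range[OF 3(1)] n by simp
    next
      case 4
      then show ?thesis using T_in[OF 4(1)] T_centre S_range[OF 4(1)] by simp
    next
      case 5
      then show ?thesis
        using T_rot[of ?c'] cells T_centre S_range[of "rot ?c'"] odd_square by simp
    qed
  qed
  have T_range: "T c \<in> {1..k\<^sup>2}" if "c \<in> {..<k} \<times> {..<k}" for c
    using kind[OF that] T_in[of c] T_rot[OF _ that] T_centre S_range[of c] S_range[of "rot c"] n odd_square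
    by auto
  have sum: "T c + T (rot c) = k\<^sup>2 + 1" if "c \<in> {..<k} \<times> {..<k}" for c
    using kind[OF that]
  proof (elim disjE conjE)
    assume "c \<in> ?D" "rot c \<notin> ?D"
    then show ?thesis
      using T_in[of c] T_rot[of "rot c"] rot_cell[OF that] S_range[of c] n by simp
  next
    assume "c \<notin> ?D" "rot c \<in> ?D"
    then show ?thesis
      using T_in[of "rot c"] T_rot[of c] that S_range[of "rot c"] n by simp
  next
    assume "c = (p, p)" "rot c = (p, p)" "p < k - p"
    then show ?thesis using T_centre odd_square by simp
  qed
  have inj: "inj_on T ({..<k} \<times> {..<k})"
  proof (rule inj_onI)
    fix c c' assume c: "c \<in> {..<k} \<times> {..<k}" "c' \<in> {..<k} \<times> {..<k}" and eq: "T c = T c'"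
    have small: "T c \<le> ?n \<longleftrightarrow> c \<in> ?D" if "c \<in> {..<k} \<times> {..<k}" for c
      using kind[OF that] T_in[of c] T_rot[OF _ that] T_centre S_range[of c] S_range[of "rot c"] n
      by auto
    have inj_D: "c = c'" if "c \<in> ?D" "c' \<in> ?D" "T c = T c'" for c c'
      using that T_in bij_betw_imp_inj_on[OF bijS] by (auto dest: inj_onD)
    have eq': "T (rot c) = T (rot c')" using sum[OF c(1)] sum[OF c(2)] eq by simp
    \<comment> \<open>Comparison with \<open>?n\<close> shows whether a cell or its image lies in
      the half shape; in the latter case injectivity is applied to the images.\<close>
    show "c = c'"
      using small[OF c(1)] small[OF c(2)] small[OF rot_cell(1)[OF c(1)]] small[OF rot_cell(1)[OF c(2)]]
        eq eq' kind[OF c(1)] kind[OF c(2)] inj_D[of c c'] inj_D[of "rot c" "rot c'"]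
        rot_cell(2)[OF c(1)] rot_cell(2)[OF c(2)]
      by metis
  qed
  have "bij_betw T ({..<k} \<times> {..<k}) {1..k * k}"
    unfolding bij_betw_def
  proof
    show "T ` ({..<k} \<times> {..<k}) = {1..k * k}"
      using T_range inj by (intro card_subset_eq) (auto simp: card_image power2_eq_square)
  qed (rule inj)
  then have "T \<in> standard_young_tableaux (rect_shape k k)"
    using mono by (intro standard_young_tableaux_rectI) (auto simp: T_def complete_def)
  moreover have "T (i, j) + T (k - 1 - i, k - 1 - j) = k\<^sup>2 + 1" if "i < k" "j < k" for i j
    using sum[of "(i, j)"] that by (simp add: rot_def)
  ultimately show "complete S \<in> self_complementary_tableaux k"
    by (auto simp: self_complementary_tableaux_def T_def)
  show "complete S c \<le> ?n \<longleftrightarrow> c \<in> ?D" if "c \<in> {..<k} \<times> {..<k}" for c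
    using kind[OF that] T_in[of c] T_rot[OF _ that] T_centre S_range[of c] S_range[of "rot c"] n
    by (auto simp: T_def)
qed

text \<open>The lower rows have the gaps as lengths, and an element of \<open>U\<close> is its index
  plus its gap. So different subsets have different half shapes.\<close>

lemma U_from_diagram: "U = {u. \<exists>i<p. u = i + card {j. (k - 1 - i, j) \<in> young_diagram shape}}"
proof -
  have "card {j. (k - 1 - i, j) \<in> young_diagram shape} = gap i" if "i < p" for i
  proof -
    have "k - p \<le> k - 1 - i" "k - 1 - i < k" "k - 1 - (k - 1 - i) = i" using that k by auto
    then have "{j. (k - 1 - i, j) \<in> young_diagram shape} = {..<gap i}"
      by (auto simp: young_diagram_def length_shape nth_shape(3))
    then show ?thesis by simp
  qed
  then have "{u. \<exists>i<p. u = i + card {j. (k - 1 - i, j) \<in> young_diagram shape}} = (\<lambda>i. i + gap i) ` {..<p}"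
    by auto
  also have "\<dots> = (\<lambda>i. sorted_list_of_set U ! i) ` {..<p}"
    by (intro image_cong refl) (simp add: enum_eq)
  also have "\<dots> = U" by (rule bij_betw_imp_surj_on[OF enum_bij])
  finally show ?thesis ..
qed

end

text \<open>A subset \<open>U\<close> together with a tableau of its half shape is sent to the
  completed tableau. This is injective: the size of the half shape is the same for all
  \<open>U\<close>, the cells with entries up to this size form the half shape, and their entries
  are the given tableau.\<close>

lemma card_self_complementary_tableaux:
  assumes k: "k = 2 * p \<or> k = 2 * p + 1"
  shows "(2 * (p * (k - p)) choose (p * (k - p))) * num_SYT (rect_shape p (k - p)) ^ 2
         \<le> card (self_complementary_tableaux k)"
proof -
  let ?I = "{U. U \<subseteq> {..<2 * p} \<and> card U = p}"
  let ?shape = "half_subset.shape k p"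
  have loc: "half_subset k p U" if "U \<in> ?I" for U using k that by (auto simp: half_subset_def)
  let ?f = "\<lambda>(U, S). half_subset.complete k p U S"
  have "finite ?I" by (rule finite_subset[of _ "Pow {..<2 * p}"]) auto
  then have "(\<Sum>U\<in>?I. num_SYT (?shape U)) = card (SIGMA U:?I. standard_young_tableaux (?shape U))"
    by (simp add: card_SigmaI finite_standard_young_tableaux num_SYT_def)
  also have "\<dots> \<le> card (self_complementary_tableaux k)"
  proof (rule card_inj_on_le[where f = ?f])
    show "?f ` (SIGMA U:?I. standard_young_tableaux (?shape U)) \<subseteq> self_complementary_tableaux k"
      using half_subset.complete_self_complementary(1)[OF loc] by auto
    show "finite (self_complementary_tableaux k)"
      unfolding self_complementary_tableaux_def using finite_standard_young_tableaux by simp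
    show "inj_on ?f (SIGMA U:?I. standard_young_tableaux (?shape U))"
    proof (rule inj_onI)
      fix a b
      assume ab: "a \<in> (SIGMA U:?I. standard_young_tableaux (?shape U))"
        "b \<in> (SIGMA U:?I. standard_young_tableaux (?shape U))" and "?f a = ?f b"
      obtain U S U' S' where [simp]: "a = (U, S)" "b = (U', S')" by (cases a, cases b)
      have U: "U \<in> ?I" "U' \<in> ?I" and S: "S \<in> standard_young_tableaux (?shape U)"
        "S' \<in> standard_young_tableaux (?shape U')" using ab by auto
      note L = loc[OF U(1)] loc[OF U(2)]
      have eq: "half_subset.complete k p U S = half_subset.complete k p U' S'"
        using \<open>?f a = ?f b\<close> by simp
      have "c \<in> young_diagram (?shape U) \<longleftrightarrow> c \<in> young_diagram (?shape U')"
        if "c \<in> {..<k} \<times> {..<k}" for c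
        using half_subset.complete_self_complementary(2)[OF L(1) S(1) that]
          half_subset.complete_self_complementary(2)[OF L(2) S(2) that] eq
        by (simp add: half_subset.sum_list_shape[OF L(1)] half_subset.sum_list_shape[OF L(2)])
      then have D: "young_diagram (?shape U) = young_diagram (?shape U')"
        using half_subset.diagram_subset[OF L(1)] half_subset.diagram_subset[OF L(2)] by blast
      then have "U = U'"
        using half_subset.U_from_diagram[OF L(1)] half_subset.U_from_diagram[OF L(2)] by simp
      moreover have "S = S'"
      proof (rule extensionalityI)
        show "S \<in> extensional (young_diagram (?shape U))" "S' \<in> extensional (young_diagram (?shape U))"
          using S D by (auto simp: standard_young_tableaux_def)
        show "S c = S' c" if "c \<in> young_diagram (?shape U)" for c
          using half_subset.complete_in_diagram[OF L(1)] half_subset.complete_in_diagram[OF L(2)] that D eq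
          by metis
      qed
      ultimately show "a = b" by simp
    qed
  qed
  finally show ?thesis unfolding sum_num_SYT_half_shapes[OF k] .
qed

section \<open>The lower bound\<close>

text \<open>Pigeonhole: the grade \<open>h\<close> strictly increases along an increasing
  subsequence, and it takes only \<open>k\<close> values.\<close>

lemma avoids_increasing_if_graded:
  assumes h: "\<And>x. x \<in> {1..n} \<Longrightarrow> h x < k"
    and mono: "\<And>x y. x \<in> {1..n} \<Longrightarrow> y \<in> {1..n} \<Longrightarrow> x < y \<Longrightarrow> \<pi> x < \<pi> y \<Longrightarrow> h x < (h y :: nat)"
  shows "avoids n \<pi> (k + 1) id"
  unfolding avoids_def
proof
  assume "\<exists>\<iota>. occurrence n \<pi> (k + 1) id \<iota>"
  then obtain \<iota> where \<iota>: "\<iota> \<in> {1..k+1} \<rightarrow> {1..n}" "strict_mono_on {1..k+1} \<iota>"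
    "\<forall>j\<in>{1..k+1}. \<forall>l\<in>{1..k+1}. \<pi> (\<iota> j) < \<pi> (\<iota> l) \<longleftrightarrow> j < l"
    by (auto simp: occurrence_def)
  have "strict_mono_on {1..k+1} (h \<circ> \<iota>)"
  proof (rule strict_mono_onI)
    fix i j assume "i \<in> {1..k+1}" "j \<in> {1..k+1}" "i < j"
    then show "(h \<circ> \<iota>) i < (h \<circ> \<iota>) j"
      unfolding o_def using \<iota> strict_mono_onD[OF \<iota>(2)] by (intro mono) auto
  qed
  then have "inj_on (h \<circ> \<iota>) {1..k+1}" by (rule strict_mono_on_imp_inj_on)
  moreover have "(h \<circ> \<iota>) j < k" if "j \<in> {1..k+1}" for j
    using h[OF funcset_mem[OF \<iota>(1) that]] by simp
  then have "(h \<circ> \<iota>) ` {1..k+1} \<subseteq> {..<k}" by blast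
  ultimately have "card {1..k+1} \<le> card {..<k}" by (rule card_inj_on_le) simp
  then show False by simp
qed

section \<open>The permutation of a family of tableaux\<close>

locale tableau_family =
  fixes k :: nat and g :: "nat \<Rightarrow> nat \<times> nat \<Rightarrow> nat"
  assumes g: "r < k \<Longrightarrow> g r \<in> self_complementary_tableaux k"
begin

definition cells :: "(nat \<times> nat \<times> nat) set" where
  "cells = {..<k} \<times> {..<k} \<times> {..<k}"

text \<open>Blocks count from 0 and entries from 1, so the labels fill 1, ..., k^3 without
  overlap.\<close>

definition label :: "nat \<times> nat \<times> nat \<Rightarrow> nat" where
  "label = (\<lambda>(r, a, b). r * k\<^sup>2 + g r (a, b))"

definition turn :: "nat \<times> nat \<times> nat \<Rightarrow> nat \<times> nat \<times> nat" where
  "turn = (\<lambda>(r, a, b). (k - 1 - r, b, k - 1 - a))"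

text \<open>The tableaux are turned by 90 degrees and the order of the blocks is reversed. So the square of
  the permutation turns each tableau by 180 degrees, which reverses every block because the
  tableaux are self-complementary.\<close>

definition perm :: "nat \<Rightarrow> nat" where
  "perm x = (if x \<in> {1..k^3} then label (turn (the_inv_into cells label x)) else x)"

lemma range: "r < k \<Longrightarrow> a < k \<Longrightarrow> b < k \<Longrightarrow> 1 \<le> g r (a, b) \<and> g r (a, b) \<le> k\<^sup>2"
proof -
  assume "r < k" "a < k" "b < k"
  then have "g r \<in> standard_young_tableaux (rect_shape k k)" "(a, b) \<in> young_diagram (rect_shape k k)"
    using g by (auto simp: self_complementary_tableaux_def young_diagram_rect)
  then have "g r (a, b) \<in> {1..sum_list (rect_shape k k)}"
    unfolding standard_young_tableaux_def using bij_betwE by blast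
  then show ?thesis by (simp add: rect_shape_def sum_list_replicate power2_eq_square)
qed

lemma not_le_cell:
  assumes "r < k" "a < k" "b < k" "g r (a, b) < g r (a', b')"
  shows "\<not> (a' \<le> a \<and> b' \<le> b)"
proof
  assume le: "a' \<le> a \<and> b' \<le> b"
  have "g r \<in> standard_young_tableaux (rect_shape k k)"
    using g assms(1) by (auto simp: self_complementary_tableaux_def)
  then have "g r (a', b') < g r (a, b)" if "(a', b') \<noteq> (a, b)"
    using le that assms
    by (intro standard_young_tableau_strict_mono[OF sorted_rect_shape]) (auto simp: young_diagram_rect)
  then show False using assms(4) by force
qed

lemma strict_mono_cell:
  assumes "r < k" "a' < k" "b' < k" "a \<le> a'" "b \<le> b'" "(a, b) \<noteq> (a', b')"
  shows "g r (a, b) < g r (a', b')"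
proof -
  have "g r \<in> standard_young_tableaux (rect_shape k k)"
    using g assms(1) by (auto simp: self_complementary_tableaux_def)
  then show ?thesis
    using assms
    by (intro standard_young_tableau_strict_mono[OF sorted_rect_shape]) (auto simp: young_diagram_rect)
qed

lemma complement: "r < k \<Longrightarrow> a < k \<Longrightarrow> b < k \<Longrightarrow> g r (k - 1 - a, k - 1 - b) = k\<^sup>2 + 1 - g r (a, b)"
  using g[of r] by (fastforce simp: self_complementary_tableaux_def)

lemma label_less:
  assumes "(r, a, b) \<in> cells" "(r', a', b') \<in> cells"
  shows "label (r, a, b) < label (r', a', b') \<longleftrightarrow> r < r' \<or> r = r' \<and> g r (a, b) < g r (a', b')"
proof -
  have lt: "label (r, a, b) < label (r', a', b')" if "r < r'" "r' < k" "a < k" "b < k" "a' < k" "b' < k"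
    for r a b r' a' b'
  proof -
    have "Suc r * k\<^sup>2 \<le> r' * k\<^sup>2" using that by (intro mult_le_mono1) simp
    then show ?thesis using range[of r a b] range[of r' a' b'] that by (simp add: label_def)
  qed
  show ?thesis
  proof (cases r r' rule: linorder_cases)
    case less
    then show ?thesis using lt assms by (auto simp: cells_def)
  next
    case equal
    then show ?thesis by (simp add: label_def)
  next
    case greater
    then show ?thesis using lt[of r' r a' b' a b] assms by (auto simp: cells_def)
  qed
qed

lemma label_bij: "bij_betw label cells {1..k^3}"
proof -
  have inj_g: "inj_on (g r) ({..<k} \<times> {..<k})" if "r < k" for r
    using g[OF that] by (auto simp: self_complementary_tableaux_def standard_young_tableaux_def
        young_diagram_rect bij_betw_def)
  have inj: "inj_on label cells"
  proof (rule inj_onI)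
    fix c c' assume *: "c \<in> cells" "c' \<in> cells" "label c = label c'"
    obtain r a b r' a' b' where [simp]: "c = (r, a, b)" "c' = (r', a', b')" by (cases c, cases c')
    have c: "(r, a, b) \<in> cells" "(r', a', b') \<in> cells" and eq: "label (r, a, b) = label (r', a', b')"
      using * by auto
    then have "r = r'" using label_less[OF c] label_less[OF c(2,1)] by simp
    moreover have "g r (a, b) = g r (a', b')" using eq \<open>r = r'\<close> by (simp add: label_def)
    then have "(a, b) = (a', b')" using inj_g[of r] c \<open>r = r'\<close> by (auto simp: cells_def dest: inj_onD)
    ultimately show "c = c'" by simp
  qed
  have "label ` cells \<subseteq> {1..k^3}"
  proof clarify
    fix r a b assume "(r, a, b) \<in> cells"
    then have "r < k" "a < k" "b < k" by (auto simp: cells_def)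
    moreover from this have "Suc r * k\<^sup>2 \<le> k * k\<^sup>2" by (intro mult_le_mono1) simp
    ultimately show "label (r, a, b) \<in> {1..k^3}"
      using range[of r a b] by (simp add: label_def power2_eq_square power3_eq_cube)
  qed
  moreover have "card (label ` cells) = k^3"
    using inj by (simp add: card_image) (simp add: cells_def power3_eq_cube)
  ultimately have "label ` cells = {1..k^3}" by (intro card_subset_eq) auto
  then show ?thesis using inj by (simp add: bij_betw_def)
qed

lemma turn_in_cells: "c \<in> cells \<Longrightarrow> turn c \<in> cells"
  by (auto simp: cells_def turn_def)

lemma perm_label: "c \<in> cells \<Longrightarrow> perm (label c) = label (turn c)"
  using label_bij by (auto simp: perm_def bij_betw_def the_inv_into_f_f)

lemma cell_exists:
  assumes "x \<in> {1..k^3}"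
  obtains r a b where "(r, a, b) \<in> cells" "x = label (r, a, b)"
  using assms label_bij unfolding bij_betw_def by (metis imageE surj_pair)

lemma perm_permutes: "perm permutes {1..k^3}"
proof (rule bij_imp_permutes)
  have "bij_betw turn cells cells"
    by (rule bij_betw_byWitness[where f' = "\<lambda>(r, a, b). (k - 1 - r, k - 1 - b, a)"])
       (auto simp: cells_def turn_def)
  then have "bij_betw (label \<circ> turn \<circ> the_inv_into cells label) {1..k^3} {1..k^3}"
    using label_bij by (intro bij_betw_trans[OF bij_betw_the_inv_into] bij_betw_trans[of turn]) auto
  then show "bij_betw perm {1..k^3} {1..k^3}"
    by (rule bij_betw_cong[THEN iffD1, rotated]) (simp add: perm_def)
qed (auto simp: perm_def)

text \<open>The order of the blocks is reversed, so an ascent stays within a block. If b' <= b, the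
  increase of the entries in \<open>g r\<close> forces a < a', and the increase at the turned cells
  forces a' < a.\<close>

lemma ascent:
  assumes c: "(r, a, b) \<in> cells" "(r', a', b') \<in> cells"
    and "label (r, a, b) < label (r', a', b')"
    and "perm (label (r, a, b)) < perm (label (r', a', b'))"
  shows "r = r' \<and> b < b'"
proof -
  have "label (k - 1 - r, b, k - 1 - a) < label (k - 1 - r', b', k - 1 - a')"
    using assms perm_label by (simp add: turn_def)
  moreover have turned: "(k - 1 - r, b, k - 1 - a) \<in> cells" "(k - 1 - r', b', k - 1 - a') \<in> cells"
    using c by (auto simp: cells_def)
  ultimately have "k - 1 - r < k - 1 - r' \<or>
      k - 1 - r = k - 1 - r' \<and> g (k - 1 - r) (b, k - 1 - a) < g (k - 1 - r) (b', k - 1 - a')"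
    using label_less by blast
  moreover have "r < r' \<or> r = r' \<and> g r (a, b) < g r (a', b')"
    using label_less[OF c] assms(3) by blast
  ultimately have "r = r'" "g r (a, b) < g r (a', b')"
      "g (k - 1 - r) (b, k - 1 - a) < g (k - 1 - r) (b', k - 1 - a')"
    using c by (auto simp: cells_def)
  then show ?thesis
    using not_le_cell[of r a b a' b'] not_le_cell[of "k - 1 - r" b "k - 1 - a" b' "k - 1 - a'"] c
    by (auto simp: cells_def)
qed

text \<open>As in \<open>ascent\<close>, with the second comparison reversed: a' <= a would force b
  < b' in \<open>g r\<close> and b' < b at the turned cells.\<close>

lemma descent_in_block:
  assumes c: "(r, a, b) \<in> cells" "(r, a', b') \<in> cells"
    and "label (r, a, b) < label (r, a', b')"
    and "perm (label (r, a', b')) < perm (label (r, a, b))"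
  shows "a < a'"
proof -
  have "label (k - 1 - r, b', k - 1 - a') < label (k - 1 - r, b, k - 1 - a)"
    using assms perm_label by (simp add: turn_def)
  moreover have "(k - 1 - r, b, k - 1 - a) \<in> cells" "(k - 1 - r, b', k - 1 - a') \<in> cells"
    using c by (auto simp: cells_def)
  ultimately have "g (k - 1 - r) (b', k - 1 - a') < g (k - 1 - r) (b, k - 1 - a)"
    using label_less by blast
  moreover have "g r (a, b) < g r (a', b')" using label_less[OF c] assms(3) by blast
  ultimately show ?thesis
    using not_le_cell[of r a b a' b'] not_le_cell[of "k - 1 - r" b' "k - 1 - a'" b "k - 1 - a"] c
    by (auto simp: cells_def)
qed

text \<open>Increasing subsequences of the permutation are graded by the column, by
  \<open>ascent\<close>; those of its square by the block, since the square preserves the blocks and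
  reverses each of them.\<close>

lemma perm_in_SAv: "perm \<in> SAv (k^3) (k + 1) id"
proof -
  define cell where "cell = the_inv_into cells label"
  have cell: "cell (label c) = c" if "c \<in> cells" for c
    using label_bij that by (auto simp: cell_def bij_betw_def the_inv_into_f_f)
  have "avoids (k^3) perm (k + 1) id"
  proof (rule avoids_increasing_if_graded[where h = "\<lambda>x. snd (snd (cell x))"])
    fix x assume "x \<in> {1..k^3}"
    then obtain r a b where "(r, a, b) \<in> cells" "x = label (r, a, b)" by (rule cell_exists)
    then show "snd (snd (cell x)) < k" by (simp add: cell) (simp add: cells_def)
  next
    fix x y assume "x \<in> {1..k^3}" "y \<in> {1..k^3}" and less: "x < y" "perm x < perm y"
    then obtain r a b r' a' b' where "(r, a, b) \<in> cells" "x = label (r, a, b)"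
      "(r', a', b') \<in> cells" "y = label (r', a', b')" by (metis cell_exists)
    then show "snd (snd (cell x)) < snd (snd (cell y))"
      using ascent[of r a b r' a' b'] less by (simp add: cell)
  qed
  moreover have "avoids (k^3) (perm \<circ> perm) (k + 1) id"
  proof (rule avoids_increasing_if_graded[where h = "\<lambda>x. fst (cell x)"])
    fix x assume "x \<in> {1..k^3}"
    then obtain r a b where "(r, a, b) \<in> cells" "x = label (r, a, b)" by (rule cell_exists)
    then show "fst (cell x) < k" by (simp add: cell) (simp add: cells_def)
  next
    fix x y assume "x \<in> {1..k^3}" "y \<in> {1..k^3}" and less: "x < y" "(perm \<circ> perm) x < (perm \<circ> perm) y"
    then obtain r a b r' a' b' where c: "(r, a, b) \<in> cells" "x = label (r, a, b)"
      "(r', a', b') \<in> cells" "y = label (r', a', b')" by (metis cell_exists)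
    have square: "perm (perm (label (r, a, b))) = label (r, k - 1 - a, k - 1 - b)"
      if "(r, a, b) \<in> cells" for r a b
      using that perm_label[OF that] perm_label[OF turn_in_cells[OF that]]
      by (auto simp: turn_def cells_def)
    have "(r, k - 1 - a, k - 1 - b) \<in> cells" "(r', k - 1 - a', k - 1 - b') \<in> cells"
      using c by (auto simp: cells_def)
    then have "r < r' \<or> r = r' \<and> g r (k - 1 - a, k - 1 - b) < g r (k - 1 - a', k - 1 - b')"
      using less(2) label_less square c by auto
    moreover have "r < r' \<or> r = r' \<and> g r (a, b) < g r (a', b')"
      using less(1) label_less c by auto
    ultimately have "r < r'"
      using complement[of r a b] complement[of r a' b'] c by (auto simp: cells_def)
    then show "fst (cell x) < fst (cell y)" using c by (simp add: cell)
  qed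
  ultimately show ?thesis using perm_permutes by (simp add: SAv_def)
qed

end

section \<open>Recovering the tableaux from the permutation\<close>

text \<open>The permutation determines the cell of each label. Steps along a row of one family are
  ascents, and an ascent raises the column with respect to every family with this permutation; steps
  down a column are descents within a block, which raise the row. Used in both directions, this
  yields equal cells.\<close>

lemma tableau_family_cell_le:
  assumes "tableau_family k g" "tableau_family k g'"
    and perm: "tableau_family.perm k g = tableau_family.perm k g'"
    and c: "(r, a, b) \<in> tableau_family.cells k" "(r', a', b') \<in> tableau_family.cells k"
    and eq: "tableau_family.label k g (r, a, b) = tableau_family.label k g' (r', a', b')"
  shows "r = r' \<and> a \<le> a' \<and> b \<le> b'"
proof -
  interpret g: tableau_family k g by fact
  interpret g': tableau_family k g' by fact
  have block: "r = r'" if "(r, a, b) \<in> g.cells" "(r', a', b') \<in> g.cells" "g.label (r, a, b) = g'.label (r', a', b')"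
    for r a b r' a' b'
  proof -
    \<comment> \<open>Entries in a block start at 1, so 1 is subtracted before the division by the
      block size.\<close>
    have *: "(s * k\<^sup>2 + t - 1) div k\<^sup>2 = s" if "1 \<le> t \<and> t \<le> k\<^sup>2" for s t
    proof -
      have "s * k\<^sup>2 + t - 1 = (t - 1) + s * k\<^sup>2" using that by simp
      also have "\<dots> div k\<^sup>2 = s + (t - 1) div k\<^sup>2" by (rule div_mult_self1) (use that in linarith)
      also have "(t - 1) div k\<^sup>2 = 0" using that by (intro div_less) auto
      finally show ?thesis by simp
    qed
    show ?thesis
      using that *[OF g.range[of r a b], of r] *[OF g'.range[of r' a' b'], of r']
      by (simp add: g.cells_def g.label_def g'.label_def)
  qed
  have cell: "\<exists>a' b'. (r, a', b') \<in> g.cells \<and> g.label (r, a, b) = g'.label (r, a', b')"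
    if "(r, a, b) \<in> g.cells" for r a b
  proof -
    have "g.label (r, a, b) \<in> {1..k^3}" using g.label_bij that by (auto simp: bij_betw_def)
    then obtain r' a' b' where "(r', a', b') \<in> g.cells" "g.label (r, a, b) = g'.label (r', a', b')"
      by (rule g'.cell_exists)
    then show ?thesis using block[OF that] by blast
  qed
  have "b \<le> b'" using c eq
  proof (induction b arbitrary: a' b')
    case (Suc b)
    then have r: "r = r'" using block by blast
    have prev: "(r, a, b) \<in> g.cells" using Suc.prems by (auto simp: g.cells_def)
    \<comment> \<open>The cell where the other family holds the label of the preceding cell; it lies
      in the same block.\<close>
    then obtain x y where xy: "(r, x, y) \<in> g.cells" "g.label (r, a, b) = g'.label (r, x, y)"
      using cell by blast
    have "g.label (r, a, b) < g.label (r, a, Suc b)"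
      using g.label_less[OF prev Suc.prems(1)] g.strict_mono_cell[of r a "Suc b" a b] Suc.prems(1)
      by (auto simp: g.cells_def)
    moreover have "g.perm (g.label (r, a, b)) < g.perm (g.label (r, a, Suc b))"
    proof -
      have "(k - 1 - r, b, k - 1 - a) \<in> g.cells" "(k - 1 - r, Suc b, k - 1 - a) \<in> g.cells"
        using Suc.prems(1) by (auto simp: g.cells_def)
      then have "g.label (k - 1 - r, b, k - 1 - a) < g.label (k - 1 - r, Suc b, k - 1 - a)"
        using g.strict_mono_cell[of "k - 1 - r" "Suc b" "k - 1 - a" b "k - 1 - a"]
        by (auto simp: g.label_less) (auto simp: g.cells_def)
      then show ?thesis using g.perm_label prev Suc.prems(1) by (simp add: g.turn_def)
    qed
    ultimately have "y < b'"
      using g'.ascent[OF xy(1) Suc.prems(2)] Suc.prems(3) xy(2) perm by simp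
    moreover have "b \<le> y" using Suc.IH[OF prev, of x y] xy r by simp
    ultimately show ?case by simp
  qed simp
  moreover have "a \<le> a'" using c eq
  proof (induction a arbitrary: a' b')
    case (Suc a)
    then have r: "r = r'" using block by blast
    have prev: "(r, a, b) \<in> g.cells" using Suc.prems by (auto simp: g.cells_def)
    then obtain x y where xy: "(r, x, y) \<in> g.cells" "g.label (r, a, b) = g'.label (r, x, y)"
      using cell by blast
    have "g.label (r, a, b) < g.label (r, Suc a, b)"
      using g.label_less[OF prev Suc.prems(1)] g.strict_mono_cell[of r "Suc a" b a b] Suc.prems(1)
      by (auto simp: g.cells_def)
    moreover have "g.perm (g.label (r, Suc a, b)) < g.perm (g.label (r, a, b))"
    proof -
      have "(k - 1 - r, b, k - 1 - a) \<in> g.cells" "(k - 1 - r, b, k - 1 - Suc a) \<in> g.cells"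
        using Suc.prems(1) by (auto simp: g.cells_def)
      then have "g.label (k - 1 - r, b, k - 1 - Suc a) < g.label (k - 1 - r, b, k - 1 - a)"
        using g.strict_mono_cell[of "k - 1 - r" b "k - 1 - a" b "k - 1 - Suc a"] Suc.prems(1)
        by (auto simp: g.label_less) (auto simp: g.cells_def)
      then show ?thesis using g.perm_label prev Suc.prems(1) by (simp add: g.turn_def)
    qed
    ultimately have "x < a'"
      using g'.descent_in_block[OF xy(1)] Suc.prems(2,3) xy(2) perm r by simp
    moreover have "a \<le> x" using Suc.IH[OF prev, of x y] xy r by simp
    ultimately show ?case by simp
  qed simp
  ultimately show ?thesis using block c eq by blast
qed

lemma card_self_complementary_le_SAv:
  "card (self_complementary_tableaux k) ^ k \<le> card (SAv (k^3) (k + 1) id)"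
proof -
  let ?F = "\<Pi>\<^sub>E r\<in>{..<k}. self_complementary_tableaux k"
  have fam: "tableau_family k g" if "g \<in> ?F" for g using that by (auto simp: tableau_family_def)
  have "card (self_complementary_tableaux k) ^ k = card ?F" by (simp add: card_PiE)
  also have "\<dots> \<le> card (SAv (k^3) (k + 1) id)"
  proof (rule card_inj_on_le)
    show "tableau_family.perm k ` ?F \<subseteq> SAv (k^3) (k + 1) id"
      using tableau_family.perm_in_SAv fam by blast
    show "finite (SAv (k^3) (k + 1) id)"
      by (rule finite_subset[OF _ finite_permutations[of "{1..k^3}"]]) (auto simp: SAv_def)
    show "inj_on (tableau_family.perm k) ?F"
    proof (rule inj_onI)
      fix g g' assume gg: "g \<in> ?F" "g' \<in> ?F" and eq: "tableau_family.perm k g = tableau_family.perm k g'"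
      interpret g: tableau_family k g by (rule fam[OF gg(1)])
      interpret g': tableau_family k g' by (rule fam[OF gg(2)])
      have val: "g r (a, b) = g' r (a, b)" if "r < k" "a < k" "b < k" for r a b
      proof -
        have c: "(r, a, b) \<in> g.cells" using that by (simp add: g.cells_def)
        then have "g.label (r, a, b) \<in> {1..k^3}" using g.label_bij by (auto simp: bij_betw_def)
        then obtain r' a' b' where c': "(r', a', b') \<in> g.cells" "g.label (r, a, b) = g'.label (r', a', b')"
          by (rule g'.cell_exists)
        have "r = r' \<and> a \<le> a' \<and> b \<le> b'"
          by (rule tableau_family_cell_le[OF fam[OF gg(1)] fam[OF gg(2)] eq c c'])
        moreover have "r' = r \<and> a' \<le> a \<and> b' \<le> b"
          by (rule tableau_family_cell_le[OF fam[OF gg(2)] fam[OF gg(1)] eq[symmetric] c'(1) c c'(2)[symmetric]])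
        ultimately show ?thesis using c'(2) by (auto simp: g.label_def g'.label_def)
      qed
      show "g = g'"
      proof (rule PiE_ext[OF gg])
        fix r assume r: "r \<in> {..<k}"
        show "g r = g' r"
        proof (rule extensionalityI)
          show "g r \<in> extensional ({..<k} \<times> {..<k})" "g' r \<in> extensional ({..<k} \<times> {..<k})"
            using g.g[of r] g'.g[of r] r
            by (auto simp: self_complementary_tableaux_def standard_young_tableaux_def young_diagram_rect)
          show "g r c = g' r c" if "c \<in> {..<k} \<times> {..<k}" for c
            using that r val by auto
        qed
      qed
    qed
  qed
  finally show ?thesis .
qed

section \<open>The upper bound\<close>

text \<open>Sets of positions ending in \<open>i\<close>. With \<open>R\<close> as
  \<open>(<)\<close> or \<open>(>)\<close> they are the increasing or decreasing
  subsequences.\<close>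

definition chains :: "(nat \<Rightarrow> nat \<Rightarrow> bool) \<Rightarrow> (nat \<Rightarrow> nat) \<Rightarrow> nat set \<Rightarrow> nat \<Rightarrow> nat set set" where
  "chains R \<pi> A i = {S. S \<subseteq> A \<and> i \<in> S \<and> (\<forall>x\<in>S. x \<le> i) \<and> monotone_on S (<) R \<pi>}"

definition chain_length :: "(nat \<Rightarrow> nat \<Rightarrow> bool) \<Rightarrow> (nat \<Rightarrow> nat) \<Rightarrow> nat set \<Rightarrow> nat \<Rightarrow> nat" where
  "chain_length R \<pi> A i = Max (card ` chains R \<pi> A i)"

lemma chain_length_attained:
  assumes "finite A" "i \<in> A"
  obtains S where "S \<in> chains R \<pi> A i" "card S = chain_length R \<pi> A i"
proof -
  have "{i} \<in> chains R \<pi> A i" using assms by (auto simp: chains_def monotone_on_def)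
  moreover have "finite (chains R \<pi> A i)"
    by (rule finite_subset[of _ "Pow A"]) (use assms in \<open>auto simp: chains_def\<close>)
  ultimately have "chain_length R \<pi> A i \<in> card ` chains R \<pi> A i"
    unfolding chain_length_def by (intro Max_in) auto
  then show ?thesis using that by auto
qed

lemma card_le_chain_length:
  assumes "finite A" "S \<in> chains R \<pi> A i"
  shows "card S \<le> chain_length R \<pi> A i"
proof -
  have "finite (chains R \<pi> A i)"
    by (rule finite_subset[of _ "Pow A"]) (use assms in \<open>auto simp: chains_def\<close>)
  then show ?thesis unfolding chain_length_def using assms by (intro Max_ge) auto
qed

text \<open>A longest chain ending in \<open>i\<close> can be extended by \<open>j\<close>.\<close>

lemma chain_length_less:
  assumes "finite A" "transp R" "i \<in> A" "j \<in> A" "i < j" "R (\<pi> i) (\<pi> j)"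
  shows "chain_length R \<pi> A i < chain_length R \<pi> A j"
proof -
  obtain S where S: "S \<in> chains R \<pi> A i" "card S = chain_length R \<pi> A i"
    using assms chain_length_attained by metis
  have le: "x \<le> i" if "x \<in> S" for x using S(1) that by (auto simp: chains_def)
  have "monotone_on (insert j S) (<) R \<pi>"
  proof (rule monotone_onI)
    fix x y assume xy: "x \<in> insert j S" "y \<in> insert j S" "x < y"
    then have x: "x \<in> S" using le[of y] assms(5) by auto
    have mono: "R (\<pi> u) (\<pi> v)" if "u \<in> S" "v \<in> S" "u < v" for u v
      using S(1) that by (auto simp: chains_def monotone_on_def)
    have "R (\<pi> x) (\<pi> j)"
    proof (cases "x = i")
      case False
      then have "R (\<pi> x) (\<pi> i)" using x le[OF x] S(1) by (intro mono) (auto simp: chains_def)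
      then show ?thesis using assms by (meson transpD)
    qed (use assms in simp)
    then show "R (\<pi> x) (\<pi> y)" using xy x mono by auto
  qed
  then have "insert j S \<in> chains R \<pi> A j"
    using S(1) assms by (auto simp: chains_def)
  then have "card (insert j S) \<le> chain_length R \<pi> A j"
    by (rule card_le_chain_length[OF assms(1)])
  moreover have "j \<notin> S" using le assms(5) by force
  moreover have "finite S" using S(1) assms(1) finite_subset by (auto simp: chains_def)
  ultimately show ?thesis using S(2) by simp
qed

lemma chain_length_bounds:
  assumes "finite A" "i \<in> A" and bound: "\<And>S. S \<subseteq> A \<Longrightarrow> monotone_on S (<) R \<pi> \<Longrightarrow> card S \<le> q"
  shows "1 \<le> chain_length R \<pi> A i" "chain_length R \<pi> A i \<le> q"
proof -
  have "{i} \<in> chains R \<pi> A i" using assms by (auto simp: chains_def monotone_on_def)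
  then show "1 \<le> chain_length R \<pi> A i" using card_le_chain_length[OF assms(1)] by fastforce
  obtain S where "S \<in> chains R \<pi> A i" "card S = chain_length R \<pi> A i"
    using assms chain_length_attained by metis
  then show "chain_length R \<pi> A i \<le> q" using bound[of S] by (auto simp: chains_def)
qed

text \<open>The labels from the proof of the theorem of Erdos and Szekeres, lowered by 1 because
  cells are counted from 0.\<close>

definition chain_cell :: "(nat \<Rightarrow> nat) \<Rightarrow> nat set \<Rightarrow> nat \<Rightarrow> nat \<times> nat" where
  "chain_cell \<pi> A i = (chain_length (>) \<pi> A i - 1, chain_length (<) \<pi> A i - 1)"

lemma chain_cell_less:
  assumes "finite A" "inj_on \<pi> A" "i \<in> A" "j \<in> A" "i < j"
  shows "\<pi> i < \<pi> j \<Longrightarrow> snd (chain_cell \<pi> A i) < snd (chain_cell \<pi> A j)"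
    and "\<pi> j < \<pi> i \<Longrightarrow> fst (chain_cell \<pi> A i) < fst (chain_cell \<pi> A j)"
proof -
  have pos: "1 \<le> chain_length R \<pi> A i" for R
    using chain_length_bounds(1)[OF assms(1,3), of R \<pi> "card A"] assms(1) by (auto intro: card_mono)
  show "\<pi> i < \<pi> j \<Longrightarrow> snd (chain_cell \<pi> A i) < snd (chain_cell \<pi> A j)"
    using chain_length_less[OF assms(1) _ assms(3-5), of "(<)" \<pi>] pos[of "(<)"]
    by (simp add: chain_cell_def transp_def)
  show "\<pi> j < \<pi> i \<Longrightarrow> fst (chain_cell \<pi> A i) < fst (chain_cell \<pi> A j)"
    using chain_length_less[OF assms(1) _ assms(3-5), of "(>)" \<pi>] pos[of "(>)"]
    by (simp add: chain_cell_def transp_def)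
qed

text \<open>Two positions form an ascent or a descent, which separates the columns or the
  rows.\<close>

lemma inj_on_chain_cell:
  assumes "finite A" "inj_on \<pi> A"
  shows "inj_on (chain_cell \<pi> A) A"
proof (rule linorder_inj_onI)
  fix i j assume ij: "i < j" "i \<in> A" "j \<in> A"
  then have "\<pi> i \<noteq> \<pi> j" using assms(2) by (auto dest: inj_onD)
  then show "chain_cell \<pi> A i \<noteq> chain_cell \<pi> A j"
    using chain_cell_less[OF assms ij(2,3,1)] by (metis less_irrefl linorder_neqE_nat)
qed auto

lemma chain_cell_range:
  assumes "finite A" "i \<in> A"
    and "\<And>S. S \<subseteq> A \<Longrightarrow> monotone_on S (<) (>) \<pi> \<Longrightarrow> card S \<le> p"
    and "\<And>S. S \<subseteq> A \<Longrightarrow> monotone_on S (<) (<) \<pi> \<Longrightarrow> card S \<le> q"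
  shows "chain_cell \<pi> A i \<in> {..<p} \<times> {..<q}"
  using chain_length_bounds[OF assms(1,2), of "(>)" \<pi> p] chain_length_bounds[OF assms(1,2), of "(<)" \<pi> q]
    assms(3,4) by (auto simp: chain_cell_def)

section \<open>Bounds for monotone subsequences\<close>

lemma avoids_increasing_card_le:
  assumes "avoids n \<pi> (k + 1) id" "S \<subseteq> {1..n}" "monotone_on S (<) (<) \<pi>"
  shows "card S \<le> k"
proof (rule ccontr)
  assume "\<not> card S \<le> k"
  then have card: "k + 1 \<le> length (sorted_list_of_set S)" by simp
  have fin: "finite S" using assms(2) finite_subset by blast
  define \<iota> where "\<iota> j = sorted_list_of_set S ! (j - 1)" for j
  have less: "\<iota> i < \<iota> j" if "i \<in> {1..k+1}" "j \<in> {1..k+1}" "i < j" for i j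
    using strict_sorted_list_of_set[of S] card that unfolding \<iota>_def sorted_wrt_iff_nth_less by auto
  have S: "\<iota> j \<in> S" if "j \<in> {1..k+1}" for j
  proof -
    have "\<iota> j \<in> set (sorted_list_of_set S)" unfolding \<iota>_def using card that by (intro nth_mem) auto
    then show ?thesis using fin by simp
  qed
  have pi_less: "\<pi> (\<iota> i) < \<pi> (\<iota> j)" if "i \<in> {1..k+1}" "j \<in> {1..k+1}" "i < j" for i j
    using assms(3) S less that by (auto simp: monotone_on_def)
  have "\<pi> (\<iota> i) < \<pi> (\<iota> j) \<longleftrightarrow> i < j" if "i \<in> {1..k+1}" "j \<in> {1..k+1}" for i j
    using pi_less[OF that] pi_less[OF that(2,1)] by (cases i j rule: linorder_cases) auto
  moreover have "strict_mono_on {1..k+1} \<iota>" using less by (rule strict_mono_onI)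
  moreover have "\<iota> \<in> {1..k+1} \<rightarrow> {1..n}" using S assms(2) by blast
  ultimately have "occurrence n \<pi> (k + 1) id \<iota>" unfolding occurrence_def by simp
  then show False using assms(1) by (auto simp: avoids_def)
qed

lemma SAv_decreasing_card_le:
  assumes \<pi>: "\<pi> \<in> SAv n (k + 1) id" and S: "S \<subseteq> {1..n}" "monotone_on S (<) (>) \<pi>"
  shows "card S \<le> k\<^sup>2"
proof -
  have perm: "\<pi> permutes {1..n}" and av: "avoids n \<pi> (k + 1) id" "avoids n (\<pi> \<circ> \<pi>) (k + 1) id"
    using \<pi> by (auto simp: SAv_def)
  have inj: "inj_on \<pi> A" for A using permutes_inj[OF perm] by (rule inj_on_subset) simp
  have fin: "finite (\<pi> ` S)" using S(1) finite_subset by blast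
  have sub: "\<pi> ` S \<subseteq> {1..n}" using S(1) permutes_image[OF perm] by blast
  have inc: "card W \<le> k" if "W \<subseteq> \<pi> ` S" "monotone_on W (<) (<) \<pi>" for W
    using av(1) that sub by (intro avoids_increasing_card_le[of n \<pi>]) auto
  \<comment> \<open>Pulled back along \<open>\<pi>\<close>, which decreases on \<open>S\<close>, a
    decreasing subsequence on the image of \<open>S\<close> becomes an increasing one of the
    square.\<close>
  have dec: "card W \<le> k" if W: "W \<subseteq> \<pi> ` S" "monotone_on W (<) (>) \<pi>" for W
  proof -
    let ?W = "{x \<in> S. \<pi> x \<in> W}"
    have "monotone_on ?W (<) (<) (\<pi> \<circ> \<pi>)"
      using S(2) W(2) by (auto simp: monotone_on_def)
    then have "card ?W \<le> k" using av(2) S(1) by (intro avoids_increasing_card_le[of n "\<pi> \<circ> \<pi>"]) auto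
    moreover have "\<pi> ` ?W = W" using W(1) by auto
    then have "card W = card ?W" using card_image[OF inj, of ?W] by simp
    ultimately show ?thesis by simp
  qed
  have "chain_cell \<pi> (\<pi> ` S) ` (\<pi> ` S) \<subseteq> {..<k} \<times> {..<k}"
    using chain_cell_range[OF fin _ dec inc] by blast
  then have "card (\<pi> ` S) \<le> card ({..<k} \<times> {..<k})"
    by (rule card_inj_on_le[OF inj_on_chain_cell[OF fin inj]]) simp
  then show ?thesis using card_image[OF inj, of S] by (simp add: power2_eq_square)
qed

text \<open>An injection between sets of the same size k^3.\<close>

lemma SAv_chain_cell_bij:
  assumes "\<pi> \<in> SAv (k^3) (k + 1) id"
  shows "bij_betw (chain_cell \<pi> {1..k^3}) {1..k^3} ({..<k\<^sup>2} \<times> {..<k})"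
proof -
  have perm: "\<pi> permutes {1..k^3}" and av: "avoids (k^3) \<pi> (k + 1) id"
    using assms by (auto simp: SAv_def)
  have inj: "inj_on (chain_cell \<pi> {1..k^3}) {1..k^3}"
    using permutes_inj_on[OF perm] by (intro inj_on_chain_cell) auto
  have "chain_cell \<pi> {1..k^3} ` {1..k^3} \<subseteq> {..<k\<^sup>2} \<times> {..<k}"
    using SAv_decreasing_card_le[OF assms] avoids_increasing_card_le[OF av]
    by (intro image_subsetI chain_cell_range) auto
  then have "chain_cell \<pi> {1..k^3} ` {1..k^3} = {..<k\<^sup>2} \<times> {..<k}"
    using inj by (intro card_subset_eq) (auto simp: card_image power2_eq_square power3_eq_cube)
  then show ?thesis using inj by (simp add: bij_betw_def)
qed

section \<open>The two tableaux of a permutation\<close>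

definition position_tableau :: "nat \<Rightarrow> (nat \<Rightarrow> nat) \<Rightarrow> nat \<times> nat \<Rightarrow> nat" where
  "position_tableau k \<pi> = restrict (the_inv_into {1..k^3} (chain_cell \<pi> {1..k^3})) ({..<k\<^sup>2} \<times> {..<k})"

text \<open>Values decrease down the columns of chain cells, so the rows are reflected.\<close>

definition value_tableau :: "nat \<Rightarrow> (nat \<Rightarrow> nat) \<Rightarrow> nat \<times> nat \<Rightarrow> nat" where
  "value_tableau k \<pi> = (\<lambda>(a, b)\<in>{..<k\<^sup>2} \<times> {..<k}. \<pi> (position_tableau k \<pi> (k\<^sup>2 - 1 - a, b)))"

context
  fixes k :: nat and \<pi> :: "nat \<Rightarrow> nat"
  assumes \<pi>: "\<pi> \<in> SAv (k^3) (k + 1) id"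
begin

private lemma perm: "\<pi> permutes {1..k^3}"
  using \<pi> by (simp add: SAv_def)

lemma position_tableau_bij: "bij_betw (position_tableau k \<pi>) ({..<k\<^sup>2} \<times> {..<k}) {1..k^3}"
  unfolding position_tableau_def bij_betw_restrict_eq
  by (rule bij_betw_the_inv_into[OF SAv_chain_cell_bij[OF \<pi>]])

lemma chain_cell_position_tableau:
  "c \<in> {..<k\<^sup>2} \<times> {..<k} \<Longrightarrow> chain_cell \<pi> {1..k^3} (position_tableau k \<pi> c) = c"
  using SAv_chain_cell_bij[OF \<pi>] unfolding position_tableau_def bij_betw_def
  by (simp add: f_the_inv_into_f)

lemma position_tableau_pair:
  assumes "(a, b) \<in> {..<k\<^sup>2} \<times> {..<k}" "(a', b') \<in> {..<k\<^sup>2} \<times> {..<k}"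
    and "position_tableau k \<pi> (a, b) < position_tableau k \<pi> (a', b')"
  shows "\<pi> (position_tableau k \<pi> (a, b)) < \<pi> (position_tableau k \<pi> (a', b')) \<Longrightarrow> b < b'"
    and "\<pi> (position_tableau k \<pi> (a', b')) < \<pi> (position_tableau k \<pi> (a, b)) \<Longrightarrow> a < a'"
proof -
  have "position_tableau k \<pi> c \<in> {1..k^3}" if "c \<in> {..<k\<^sup>2} \<times> {..<k}" for c
    using bij_betwE[OF position_tableau_bij] that by blast
  note less = chain_cell_less[OF finite_atLeastAtMost permutes_inj_on[OF perm] this[OF assms(1)]
      this[OF assms(2)] assms(3)]
  show "\<pi> (position_tableau k \<pi> (a, b)) < \<pi> (position_tableau k \<pi> (a', b')) \<Longrightarrow> b < b'"
    and "\<pi> (position_tableau k \<pi> (a', b')) < \<pi> (position_tableau k \<pi> (a, b)) \<Longrightarrow> a < a'"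
    using less chain_cell_position_tableau[OF assms(1)] chain_cell_position_tableau[OF assms(2)]
    by simp_all
qed

lemma position_tableau_distinct:
  assumes "(a, b) \<in> {..<k\<^sup>2} \<times> {..<k}" "(a', b') \<in> {..<k\<^sup>2} \<times> {..<k}" "(a, b) \<noteq> (a', b')"
  shows "position_tableau k \<pi> (a, b) \<noteq> position_tableau k \<pi> (a', b')"
    and "\<pi> (position_tableau k \<pi> (a, b)) \<noteq> \<pi> (position_tableau k \<pi> (a', b'))"
proof -
  show 1: "position_tableau k \<pi> (a, b) \<noteq> position_tableau k \<pi> (a', b')"
    using bij_betw_imp_inj_on[OF position_tableau_bij] assms by (meson inj_onD)
  then show "\<pi> (position_tableau k \<pi> (a, b)) \<noteq> \<pi> (position_tableau k \<pi> (a', b'))"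
    using permutes_inj[OF perm] by (meson injD)
qed

text \<open>If the larger cell came at the earlier position, the two positions would form an ascent
  or a descent, so the column or the row would grow towards the smaller cell.\<close>

lemma position_tableau_SYT: "position_tableau k \<pi> \<in> standard_young_tableaux (rect_shape (k\<^sup>2) k)"
proof (rule standard_young_tableaux_rectI)
  show "position_tableau k \<pi> \<in> extensional ({..<k\<^sup>2} \<times> {..<k})"
    by (simp add: position_tableau_def)
  show "bij_betw (position_tableau k \<pi>) ({..<k\<^sup>2} \<times> {..<k}) {1..k\<^sup>2 * k}"
    using position_tableau_bij by (simp add: power2_eq_square power3_eq_cube)
  fix a b a' b'
  assume le: "a \<le> a'" "b \<le> b'" and "a' < k\<^sup>2" "b' < k" and ne: "(a, b) \<noteq> (a', b')"
  then have c: "(a, b) \<in> {..<k\<^sup>2} \<times> {..<k}" "(a', b') \<in> {..<k\<^sup>2} \<times> {..<k}" by auto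
  show "position_tableau k \<pi> (a, b) < position_tableau k \<pi> (a', b')"
    using position_tableau_pair[OF c(2,1)] position_tableau_distinct[OF c ne] le
    by (meson linorder_neqE_nat not_less)
qed

text \<open>Depending on the order of the two positions, a violation would be a descent whose row
  does not grow or an ascent whose column does not grow, against
  \<open>position_tableau_pair\<close>.\<close>

lemma value_tableau_SYT: "value_tableau k \<pi> \<in> standard_young_tableaux (rect_shape (k\<^sup>2) k)"
proof (rule standard_young_tableaux_rectI)
  let ?C = "{..<k\<^sup>2} \<times> {..<k}"
  define flip where "flip = (\<lambda>(a, b). (k\<^sup>2 - 1 - a, b :: nat))"
  show "value_tableau k \<pi> \<in> extensional ?C"
    by (simp add: value_tableau_def)
  have "bij_betw flip ?C ?C"
    by (rule bij_betw_byWitness[where f' = flip]) (auto simp: flip_def)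
  then have "bij_betw (\<pi> \<circ> (position_tableau k \<pi> \<circ> flip)) ?C {1..k^3}"
    by (intro bij_betw_trans[OF bij_betw_trans[OF _ position_tableau_bij]] permutes_imp_bij[OF perm])
  then have "bij_betw (value_tableau k \<pi>) ?C {1..k^3}"
    by (rule bij_betw_cong[THEN iffD1, rotated]) (auto simp: value_tableau_def flip_def)
  then show "bij_betw (value_tableau k \<pi>) ?C {1..k\<^sup>2 * k}"
    by (simp add: power2_eq_square power3_eq_cube)
  fix a b a' b'
  assume le: "a \<le> a'" "b \<le> b'" and lt: "a' < k\<^sup>2" "b' < k" and ne: "(a, b) \<noteq> (a', b')"
  let ?c = "(k\<^sup>2 - 1 - a, b)" and ?c' = "(k\<^sup>2 - 1 - a', b')"
  have c: "?c \<in> ?C" "?c' \<in> ?C" "?c \<noteq> ?c'" using le lt ne by auto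
  have "\<pi> (position_tableau k \<pi> ?c) < \<pi> (position_tableau k \<pi> ?c')"
  proof (rule ccontr)
    assume "\<not> ?thesis"
    then have less: "\<pi> (position_tableau k \<pi> ?c') < \<pi> (position_tableau k \<pi> ?c)"
      using position_tableau_distinct(2)[OF c] by simp
    consider "position_tableau k \<pi> ?c < position_tableau k \<pi> ?c'"
      | "position_tableau k \<pi> ?c' < position_tableau k \<pi> ?c"
      using position_tableau_distinct(1)[OF c] by linarith
    then show False
    proof cases
      case 1
      then show False using position_tableau_pair(2)[OF c(1,2) 1 less] le by simp
    next
      case 2
      then show False using position_tableau_pair(1)[OF c(2,1) 2 less] le by simp
    qed
  qed
  then show "value_tableau k \<pi> (a, b) < value_tableau k \<pi> (a', b')"
    using le lt by (simp add: value_tableau_def)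
qed

end

text \<open>Every position is an entry of the first tableau, and the reflected cell of the second
  holds its value, so the pair determines the permutation.\<close>

lemma card_SAv_le: "card (SAv (k^3) (k + 1) id) \<le> num_SYT (rect_shape (k\<^sup>2) k) ^ 2"
proof -
  let ?T = "standard_young_tableaux (rect_shape (k\<^sup>2) k)"
  let ?f = "\<lambda>\<pi>. (position_tableau k \<pi>, value_tableau k \<pi>)"
  have "card (SAv (k^3) (k + 1) id) \<le> card (?T \<times> ?T)"
  proof (rule card_inj_on_le[of ?f])
    show "?f ` SAv (k^3) (k + 1) id \<subseteq> ?T \<times> ?T"
      using position_tableau_SYT value_tableau_SYT by auto
    show "finite (?T \<times> ?T)" by (simp add: finite_standard_young_tableaux)
    show "inj_on ?f (SAv (k^3) (k + 1) id)"
    proof (rule inj_onI)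
      fix \<pi> \<rho> assume perms: "\<pi> \<in> SAv (k^3) (k + 1) id" "\<rho> \<in> SAv (k^3) (k + 1) id" and "?f \<pi> = ?f \<rho>"
      then have eq: "position_tableau k \<pi> = position_tableau k \<rho>" "value_tableau k \<pi> = value_tableau k \<rho>"
        by auto
      show "\<pi> = \<rho>"
      proof
        fix x
        show "\<pi> x = \<rho> x"
        proof (cases "x \<in> {1..k^3}")
          case True
          then have "x \<in> position_tableau k \<pi> ` ({..<k\<^sup>2} \<times> {..<k})"
            using bij_betw_imp_surj_on[OF position_tableau_bij[OF perms(1)]] by simp
          then obtain a b where ab: "(a, b) \<in> {..<k\<^sup>2} \<times> {..<k}" "x = position_tableau k \<pi> (a, b)"
            by blast
          have val: "\<sigma> (position_tableau k \<sigma> (a, b)) = value_tableau k \<sigma> (k\<^sup>2 - 1 - a, b)" for \<sigma>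
            using ab(1) by (auto simp: value_tableau_def)
          show ?thesis using val[of \<pi>] val[of \<rho>] eq ab(2) by simp
        next
          case False
          then show ?thesis using perms by (auto simp: SAv_def permutes_def)
        qed
      qed
    qed
  qed
  then show ?thesis by (simp add: num_SYT_def card_cartesian_product power2_eq_square)
qed

section \<open>Both bounds together\<close>

theorem theorem1p1:
  fixes k :: nat
  assumes "k \<ge> 1"
  shows "((k^2 div 2) choose (k^2 div 4)) ^ k
           * num_SYT (rect_shape (k div 2) ((k + 1) div 2)) ^ (2 * k)
         \<le> card (SAv (k^3) (k + 1) id)
       \<and> card (SAv (k^3) (k + 1) id) \<le> num_SYT (rect_shape (k^2) k) ^ 2"
proof
  define p where "p = k div 2"
  have k: "k = 2 * p \<or> k = 2 * p + 1" by (auto simp: p_def)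
  have q: "(k + 1) div 2 = k - p" using k by auto
  \<comment> \<open>The remainder \<open>k - 2 * p\<close> is 0 or 1, so both floors can be read
    off.\<close>
  have "k\<^sup>2 = 4 * (p * (k - p)) + (k - 2 * p)"
    using k by (auto simp: power2_eq_square algebra_simps)
  then have halves: "k\<^sup>2 div 2 = 2 * (p * (k - p))" "k\<^sup>2 div 4 = p * (k - p)"
    using k by auto
  have "((k\<^sup>2 div 2) choose (k\<^sup>2 div 4)) ^ k * num_SYT (rect_shape (k div 2) ((k + 1) div 2)) ^ (2 * k)
      = ((2 * (p * (k - p)) choose (p * (k - p))) * num_SYT (rect_shape p (k - p)) ^ 2) ^ k"
    unfolding halves q p_def [symmetric] by (simp add: power_mult_distrib power_mult)
  also have "\<dots> \<le> card (self_complementary_tableaux k) ^ k"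
    by (intro power_mono card_self_complementary_tableaux[OF k]) simp
  also have "\<dots> \<le> card (SAv (k^3) (k + 1) id)" by (rule card_self_complementary_le_SAv)
  finally show "((k^2 div 2) choose (k^2 div 4)) ^ k
           * num_SYT (rect_shape (k div 2) ((k + 1) div 2)) ^ (2 * k) \<le> card (SAv (k^3) (k + 1) id)" .
  show "card (SAv (k^3) (k + 1) id) \<le> num_SYT (rect_shape (k^2) k) ^ 2"
    by (rule card_SAv_le)
qed

end
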